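(* Let $H$ be a real Hilbert space and let $D\subseteq H$ be a linear subspace. Let $\mathcal{T}:H\to D$ and $\mathcal{A}:H\to H$ be bounded linear operators, with $\mathcal{T}$ bijective (onto $D$). Define $A:=\mathcal{A}\circ\mathcal{T}^{-1}:D\to H$. Then for any $\omega\in\mathbb{R}$, $A$ is the infinitesimal generator of a quasicontraction semigroup with rate $\omega$ on $H$ if and only if both of the following are satisfied: (1) $\langle \mathcal{T}\mathbf{v},\mathcal{A}\mathbf{v}\rangle_{H}\leq \omega\langle \mathcal{T}\mathbf{v},\mathcal{T}\mathbf{v}\rangle_{H}$ for all $\mathbf{v}\in H$; (2) there exist $\epsilon>0$ and $\lambda>\omega$ such that $\|(\lambda\mathcal{T}^*-\mathcal{A}^* )\mathbf{v}\|_{H}\geq\epsilon\|\mathbf{v}\|_{H}$ for all $\mathbf{v}\in H$.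
   Context: $D$ carries the norm inherited from $H$, so $\mathcal{T}$ is regarded as a bounded operator on $H$ with range $D$, and $\mathcal{T}^*,\mathcal{A}^*$ are the adjoints in $\mathcal{L}(H)$, the space of bounded linear operators on $H$. A $C_0$-semigroup on $H$ is a family $(S(t))_{t\ge 0}$ in $\mathcal{L}(H)$ with $S(0)=I$, $S(t+s)=S(t)S(s)$ for all $t,s\ge 0$, and $\lim_{t\to0^+}S(t)\mathbf{x}=\mathbf{x}$ for all $\mathbf{x}\in H$. Its infinitesimal generator is the operator $\mathbf{x}\mapsto \lim_{t\to 0^+}\frac{1}{t}[S(t)-I]\mathbf{x}$, whose domain is exactly the set of all $\mathbf{x}\in H$ for which this limit exists in $H$; saying that $A:D\to H$ is the infinitesimal generator includes the statement that this domain equals $D$. A $C_0$-semigroup $(S(t))_{t\ge0}$ on $H$ is a quasicontraction semigroup with rate $\omega\in\mathbb{R}$ if $\|S(t)\|\le e^{\omega t}$ (operator norm on $H$) for all $t\ge 0$. *)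

theory Defs
  imports "HOL-Analysis.Analysis"
begin

text \<open>
  A family indexed by \<open>t \<ge> 0\<close> is a function on \<open>real\<close> of which only the values at
  nonnegative arguments matter.
\<close>

definition C0_semigroup :: "(real \<Rightarrow> 'a::real_normed_vector \<Rightarrow>\<^sub>L 'a) \<Rightarrow> bool" where
  "C0_semigroup S \<longleftrightarrow>
     S 0 = id_blinfun \<and>
     (\<forall>t\<ge>0. \<forall>s\<ge>0. S (t + s) = S t o\<^sub>L S s) \<and>
     (\<forall>x. ((\<lambda>t. S t x) \<longlongrightarrow> x) (at_right 0))"

definition generator_domain :: "(real \<Rightarrow> 'a::real_normed_vector \<Rightarrow>\<^sub>L 'a) \<Rightarrow> 'a set" where
  "generator_domain S =
     {x. \<exists>y. ((\<lambda>t. (1 / t) *\<^sub>R ((S t - id_blinfun) x)) \<longlongrightarrow> y) (at_right 0)}"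

definition generator :: "(real \<Rightarrow> 'a::real_normed_vector \<Rightarrow>\<^sub>L 'a) \<Rightarrow> 'a \<Rightarrow> 'a" where
  "generator S x = Lim (at_right 0) (\<lambda>t. (1 / t) *\<^sub>R ((S t - id_blinfun) x))"

text \<open>
  An operator with domain \<open>D\<close> is a pair of the set \<open>D\<close> and a function whose values
  outside \<open>D\<close> are irrelevant.
\<close>

definition is_generator ::
  "'a set \<Rightarrow> ('a \<Rightarrow> 'a) \<Rightarrow> (real \<Rightarrow> 'a::real_normed_vector \<Rightarrow>\<^sub>L 'a) \<Rightarrow> bool" where
  "is_generator D A S \<longleftrightarrow> generator_domain S = D \<and> (\<forall>x\<in>D. generator S x = A x)"

definition quasicontraction_semigroup ::
  "real \<Rightarrow> (real \<Rightarrow> 'a::real_normed_vector \<Rightarrow>\<^sub>L 'a) \<Rightarrow> bool" where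
  "quasicontraction_semigroup \<omega> S \<longleftrightarrow>
     C0_semigroup S \<and> (\<forall>t\<ge>0. norm (S t) \<le> exp (\<omega> * t))"

text \<open>
  Hilbert spaces are types of sort \<open>{real_inner, complete_space}\<close>, and Hilbert space adjoints
  are given by the library constant \<^const>\<open>adjoint\<close>. It is defined by choice; on a complete space
  a bounded operator has exactly one function satisfying the defining equation, by the Riesz
  representation theorem, and that function is again bounded and linear.
\<close>

end

theory Submission
  imports Defs
begin

text \<open>
  Since \<open>\<T>\<close> is a bijection onto \<open>D\<close>, the range of \<open>\<mu> - A\<close> is the range of the bounded operator
  \<open>B = \<mu> \<T> - \<A>\<close>, and \<open>B\<close> is surjective iff \<open>B\<^sup>*\<close> is bounded below: surjectivity makes
  \<open>{v. norm (B\<^sup>* v) \<le> 1}\<close> weakly bounded, hence bounded, and conversely \<open>B B\<^sup>*\<close> is coercive, so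
  Lax--Milgram applies. The claim thus becomes the Lumer--Phillips theorem. Its necessity part
  inverts \<open>A - (\<omega> + 1)\<close> by a primitive of an orbit over \<open>[0, 1]\<close>. In the sufficiency part the
  semigroup is the limit of the flows of the Yosida approximations, which converge because
  dissipativity bounds the derivative of \<open>(norm (u\<^sub>n - u\<^sub>m))\<^sup>2\<close>.

  The sort \<open>{real_inner, complete_space}\<close> is not below the class \<open>banach\<close>, so the library's
  vector-valued series and integrals are unavailable. Primitives and solutions of linear
  differential equations are obtained from real-valued ones by Riesz representation, and weak
  derivatives that are continuous are upgraded to strong ones.
\<close>

section \<open>Hilbert space preliminaries\<close>

text \<open>A minimizing sequence is Cauchy by the parallelogram law: midpoints stay in
  \<open>K\<close>, so their squared norms cannot fall below the infimum \<open>d\<close>.\<close>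

lemma closed_convex_min_norm:
  fixes K :: "'a::{real_inner, complete_space} set"
  assumes "closed K" "convex K" "K \<noteq> {}"
  obtains z where "z \<in> K" "\<And>w. w \<in> K \<Longrightarrow> norm z \<le> norm w"
proof -
  define d where "d = Inf ((\<lambda>w. (norm w)\<^sup>2) ` K)"
  have bdd: "bdd_below ((\<lambda>w. (norm w)\<^sup>2) ` K)" by (rule bdd_belowI[of _ 0]) auto
  have d_le: "d \<le> (norm w)\<^sup>2" if "w \<in> K" for w
    unfolding d_def using that bdd by (simp add: cInf_lower)
  have "\<exists>w\<in>K. (norm w)\<^sup>2 < d + inverse (Suc n)" for n
  proof -
    have "Inf ((\<lambda>w. (norm w)\<^sup>2) ` K) < d + inverse (Suc n)" unfolding d_def by simp
    from cInf_lessD[OF _ this] assms(3) show ?thesis by auto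
  qed
  then obtain f where fK: "\<And>n. f n \<in> K" and f: "\<And>n. (norm (f n))\<^sup>2 < d + inverse (Suc n)"
    by metis
  have para: "(norm (f m - f n))\<^sup>2 \<le> 2 * inverse (Suc m) + 2 * inverse (Suc n)" for m n
  proof -
    have "(1/2) *\<^sub>R f m + (1/2) *\<^sub>R f n \<in> K"
      using fK assms(2) by (intro convexD) auto
    from d_le[OF this] have "4 * d \<le> (norm (f m + f n))\<^sup>2"
      by (simp add: scaleR_add_right[symmetric] power_divide)
    moreover have "(norm (f m - f n))\<^sup>2 = 2 * (norm (f m))\<^sup>2 + 2 * (norm (f n))\<^sup>2 - (norm (f m + f n))\<^sup>2"
      by (simp add: power2_norm_eq_inner algebra_simps inner_commute)
    ultimately show ?thesis using f[of m] f[of n] by linarith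
  qed
  have "Cauchy f"
  proof (rule metric_CauchyI)
    fix e :: real assume "e > 0"
    then obtain N where N: "N > 0" "inverse (real N) < e\<^sup>2 / 4"
      using ex_inverse_of_nat_less[of "e\<^sup>2 / 4"] by auto
    have inv: "inverse (Suc n) < e\<^sup>2 / 4" if "n \<ge> N" for n
    proof -
      have "inverse (real (Suc n)) \<le> inverse (real N)"
        using that N by (intro le_imp_inverse_le) auto
      then show ?thesis using N(2) by (rule le_less_trans)
    qed
    show "\<exists>M. \<forall>m\<ge>M. \<forall>n\<ge>M. dist (f m) (f n) < e"
    proof (intro exI allI impI)
      fix m n assume "N \<le> m" "N \<le> n"
      have "(norm (f m - f n))\<^sup>2 < e\<^sup>2"
        using para[of m n] inv[OF \<open>N \<le> m\<close>] inv[OF \<open>N \<le> n\<close>] by linarith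
      then show "dist (f m) (f n) < e"
        using \<open>e > 0\<close> power_less_imp_less_base[of "norm (f m - f n)" 2 e] by (simp add: dist_norm)
    qed
  qed
  then obtain z where z: "f \<longlonglongrightarrow> z" using Cauchy_convergent convergent_def by blast
  have zK: "z \<in> K" using assms(1) z fK closed_sequentially by blast
  have "(norm z)\<^sup>2 \<le> d + 0"
  proof (rule LIMSEQ_le)
    show "(\<lambda>n. (norm (f n))\<^sup>2) \<longlonglongrightarrow> (norm z)\<^sup>2" using z by (intro tendsto_intros)
    show "(\<lambda>n. d + inverse (real (Suc n))) \<longlonglongrightarrow> d + 0"
      by (intro tendsto_intros LIMSEQ_inverse_real_of_nat)
    show "\<exists>N. \<forall>n\<ge>N. (norm (f n))\<^sup>2 \<le> d + inverse (real (Suc n))" using f less_imp_le by blast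
  qed
  then have "norm z \<le> norm w" if "w \<in> K" for w
    using order_trans[of _ d, OF _ d_le[OF that]] power2_le_imp_le[of "norm z" "norm w"] by simp
  with zK show ?thesis using that by blast
qed

lemma min_norm_orthogonal:
  fixes z d :: "'a::real_inner"
  assumes "\<And>s. norm z \<le> norm (z + s *\<^sub>R d)"
  shows "z \<bullet> d = 0"
proof (cases "d = 0")
  case False
  \<comment> \<open>The vertex of the quadratic \<open>(norm (z + s *\<^sub>R d))\<^sup>2\<close> in
    \<open>s\<close>; its value there is below \<open>(norm z)\<^sup>2\<close> unless
    \<open>z \<bullet> d = 0\<close>.\<close>
  define s where "s = - (z \<bullet> d) / (d \<bullet> d)"
  have dd: "d \<bullet> d > 0" using False by simp
  have "(norm z)\<^sup>2 \<le> (norm (z + s *\<^sub>R d))\<^sup>2" using assms by (simp add: power_mono)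
  then have "0 \<le> 2 * s * (z \<bullet> d) + s * s * (d \<bullet> d)"
    by (simp add: power2_norm_eq_inner inner_add inner_commute algebra_simps)
  also have "\<dots> = - ((z \<bullet> d) * (z \<bullet> d)) / (d \<bullet> d)"
    using dd by (simp add: s_def field_simps)
  finally have "(z \<bullet> d) * (z \<bullet> d) \<le> 0" using dd by (simp add: field_simps)
  then show ?thesis by (metis mult_eq_0_iff order_antisym zero_le_square)
qed simp

text \<open>The point of least norm on the hyperplane \<open>\<phi> y = 1\<close> is orthogonal to
  the kernel of \<open>\<phi>\<close>, so a multiple of it represents \<open>\<phi>\<close>.\<close>

theorem riesz_representation:
  fixes \<phi> :: "'a::{real_inner, complete_space} \<Rightarrow> real"
  assumes "bounded_linear \<phi>"
  obtains z where "\<And>y. \<phi> y = z \<bullet> y"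
proof (cases "\<forall>y. \<phi> y = 0")
  case True
  then show ?thesis using that[of 0] by simp
next
  case False
  interpret bounded_linear \<phi> by fact
  define K where "K = {y. \<phi> y = 1}"
  obtain y0 where "\<phi> y0 \<noteq> 0" using False by blast
  then have "(1 / \<phi> y0) *\<^sub>R y0 \<in> K" by (simp add: K_def scaleR)
  moreover have "closed K" unfolding K_def
    by (intro closed_Collect_eq continuous_intros linear_continuous_on assms)
  moreover have "convex K" unfolding K_def by (rule convexI) (auto simp: add scaleR)
  ultimately obtain z where zK: "z \<in> K" and min: "\<And>w. w \<in> K \<Longrightarrow> norm z \<le> norm w"
    using closed_convex_min_norm[of K] by blast
  have orth: "z \<bullet> d = 0" if "\<phi> d = 0" for d
    using zK that by (intro min_norm_orthogonal min) (simp add: K_def add scaleR)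
  have "z \<noteq> 0" using zK by (auto simp: K_def zero)
  have "\<phi> y = ((1 / (z \<bullet> z)) *\<^sub>R z) \<bullet> y" for y
  proof -
    have "z \<bullet> (y - \<phi> y *\<^sub>R z) = 0" using zK by (intro orth) (simp add: K_def diff scaleR)
    then show ?thesis using \<open>z \<noteq> 0\<close> by (simp add: inner_diff_right field_simps)
  qed
  with that show ?thesis by blast
qed

lemma closure_subspace:
  fixes D :: "'a::real_normed_vector set"
  assumes "subspace D"
  shows "subspace (closure D)"
proof (rule subspaceI)
  show "0 \<in> closure D" using subspace_0[OF assms] closure_subset by blast
next
  fix x y assume "x \<in> closure D" "y \<in> closure D"
  then obtain f g where "\<And>n. f n \<in> D" "f \<longlonglongrightarrow> x" "\<And>n. g n \<in> D" "g \<longlonglongrightarrow> y"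
    by (auto simp: closure_sequential)
  then have "(\<lambda>n. f n + g n) \<longlonglongrightarrow> x + y" "\<And>n. f n + g n \<in> D"
    using assms by (auto intro: tendsto_add subspace_add)
  then show "x + y \<in> closure D" unfolding closure_sequential by (intro exI[of _ "\<lambda>n. f n + g n"]) auto
next
  fix c :: real and x assume "x \<in> closure D"
  then obtain f where "\<And>n. f n \<in> D" "f \<longlonglongrightarrow> x" by (auto simp: closure_sequential)
  then have "(\<lambda>n. c *\<^sub>R f n) \<longlonglongrightarrow> c *\<^sub>R x" "\<And>n. c *\<^sub>R f n \<in> D"
    using assms by (auto intro: tendsto_scaleR subspace_scale)
  then show "c *\<^sub>R x \<in> closure D" unfolding closure_sequential by (intro exI[of _ "\<lambda>n. c *\<^sub>R f n"]) auto
qed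

text \<open>The point of least norm in the coset \<open>y + closure D\<close> is orthogonal to
  \<open>D\<close>, hence 0, which puts \<open>y\<close> into \<open>closure D\<close>.\<close>

lemma dense_subspace_if_orthogonal_trivial:
  fixes D :: "'a::{real_inner, complete_space} set"
  assumes "subspace D" and triv: "\<And>z. (\<And>d. d \<in> D \<Longrightarrow> z \<bullet> d = 0) \<Longrightarrow> z = 0"
  shows "closure D = UNIV"
proof -
  have "y \<in> closure D" for y
  proof -
    let ?K = "(+) y ` closure D"
    have sub: "subspace (closure D)" using assms(1) by (rule closure_subspace)
    have "closed ?K" by (intro closed_translation) simp
    moreover have "convex ?K" using sub by (intro convex_translation subspace_imp_convex)
    moreover have "?K \<noteq> {}" using subspace_0[OF sub] by auto
    ultimately obtain z where zK: "z \<in> ?K" and min: "\<And>w. w \<in> ?K \<Longrightarrow> norm z \<le> norm w"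
      using closed_convex_min_norm[of ?K] by blast
    obtain k where k: "k \<in> closure D" "z = y + k" using zK by auto
    have "z \<bullet> d = 0" if "d \<in> D" for d
    proof (rule min_norm_orthogonal, rule min)
      fix s show "z + s *\<^sub>R d \<in> ?K"
        using k subspace_add[OF sub k(1) subspace_scale[OF sub, of d s]] that closure_subset
        by (auto intro!: image_eqI[of _ _ "k + s *\<^sub>R d"])
    qed
    then have "z = 0" by (rule triv)
    then have "y = - k" using k by (simp add: eq_neg_iff_add_eq_0)
    then show ?thesis using subspace_neg[OF sub k(1)] by simp
  qed
  then show ?thesis by blast
qed

text \<open>Lax--Milgram: \<open>v \<mapsto> v - \<rho> (C v - f)\<close> is a contraction for the right \<open>\<rho>\<close>.\<close>

lemma coercive_surj:
  fixes C :: "'a::{real_inner, complete_space} \<Rightarrow> 'a"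
  assumes "bounded_linear C" "c > 0" and coer: "\<And>v. C v \<bullet> v \<ge> c * (norm v)\<^sup>2"
  shows "surj C"
proof -
  interpret bounded_linear C by fact
  obtain K0 where K0: "\<And>x. norm (C x) \<le> norm x * K0" using pos_bounded by blast
  \<comment> \<open>Taking \<open>K \<ge> c\<close> makes \<open>q\<close> below nonnegative, so
    that \<open>sqrt q\<close> can serve as contraction factor.\<close>
  define K where "K = max K0 c"
  have K: "K \<ge> c" "K > 0" using assms(2) by (auto simp: K_def)
  have bound: "norm (C x) \<le> K * norm x" for x
    using K0[of x] mult_left_mono[of K0 K "norm x"] by (simp add: K_def mult.commute)
  define q where "q = 1 - (c / K)\<^sup>2"
  have "0 < (c / K)\<^sup>2" "(c / K)\<^sup>2 \<le> 1" using K assms(2) by (auto simp: power_le_one)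
  then have q: "0 \<le> q" "q < 1" by (auto simp: q_def)
  \<comment> \<open>The minimizer of \<open>1 - 2 * \<rho> * c + \<rho>\<^sup>2 * K\<^sup>2\<close>,
    whose minimum is \<open>q\<close>.\<close>
  define \<rho> where "\<rho> = c / K\<^sup>2"
  have "\<rho> > 0" using K assms(2) by (simp add: \<rho>_def)
  have contr: "norm (w - \<rho> *\<^sub>R C w) \<le> sqrt q * norm w" for w
  proof -
    have "(norm (w - \<rho> *\<^sub>R C w))\<^sup>2 = (norm w)\<^sup>2 - 2 * \<rho> * (C w \<bullet> w) + \<rho>\<^sup>2 * (norm (C w))\<^sup>2"
      unfolding power2_norm_eq_inner
      by (simp add: inner_diff_left inner_diff_right inner_commute[of w "C w"])
        (simp add: power2_eq_square algebra_simps)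
    also have "\<dots> \<le> (norm w)\<^sup>2 - 2 * \<rho> * (c * (norm w)\<^sup>2) + \<rho>\<^sup>2 * (K * norm w)\<^sup>2"
    proof -
      have "2 * \<rho> * (c * (norm w)\<^sup>2) \<le> 2 * \<rho> * (C w \<bullet> w)"
        using coer[of w] \<open>\<rho> > 0\<close> by simp
      moreover have "\<rho>\<^sup>2 * (norm (C w))\<^sup>2 \<le> \<rho>\<^sup>2 * (K * norm w)\<^sup>2"
        using power_mono[OF bound, of w 2] by (simp add: mult_left_mono)
      ultimately show ?thesis by linarith
    qed
    also have "\<dots> = q * (norm w)\<^sup>2"
    proof -
      have "2 * \<rho> * (c * (norm w)\<^sup>2) = 2 * (\<rho> * c) * (norm w)\<^sup>2"
        "\<rho>\<^sup>2 * (K * norm w)\<^sup>2 = (\<rho> * K)\<^sup>2 * (norm w)\<^sup>2"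
        by (auto simp: power_mult_distrib)
      moreover have "\<rho> * c = (c / K)\<^sup>2" "\<rho> * K = c / K"
        using K by (auto simp: \<rho>_def power2_eq_square)
      ultimately show ?thesis by (simp add: q_def left_diff_distrib)
    qed
    also have "\<dots> = (sqrt q * norm w)\<^sup>2" using q by (simp add: power_mult_distrib)
    finally show ?thesis by (rule power2_le_imp_le) (use q in simp)
  qed
  have "\<exists>v. C v = f" for f
  proof -
    have "\<exists>!v. v - \<rho> *\<^sub>R (C v - f) = v"
    proof (rule banach_fix_type[of "sqrt q"])
      show "0 \<le> sqrt q" "sqrt q < 1" using q by auto
      show "\<forall>x y. dist (x - \<rho> *\<^sub>R (C x - f)) (y - \<rho> *\<^sub>R (C y - f)) \<le> sqrt q * dist x y"
      proof (intro allI)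
        fix x y
        have "x - \<rho> *\<^sub>R (C x - f) - (y - \<rho> *\<^sub>R (C y - f)) = (x - y) - \<rho> *\<^sub>R C (x - y)"
          by (simp add: diff algebra_simps)
        then show "dist (x - \<rho> *\<^sub>R (C x - f)) (y - \<rho> *\<^sub>R (C y - f)) \<le> sqrt q * dist x y"
          using contr[of "x - y"] by (simp only: dist_norm)
      qed
    qed
    then obtain v where "v - \<rho> *\<^sub>R (C v - f) = v" by blast
    then show ?thesis using \<open>\<rho> > 0\<close> by auto
  qed
  then have "\<exists>v. f = C v" for f by (metis (no_types))
  then show ?thesis unfolding surj_def by blast
qed

section \<open>Adjoints, uniform boundedness and surjectivity\<close>

text \<open>Since \<open>adjoint\<close> is a choice, its defining equation holds only once some
  function satisfies it; Riesz representation of \<open>x \<mapsto> B x \<bullet> y\<close> for each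
  \<open>y\<close> supplies one.\<close>

lemma adjoint_inner:
  fixes B :: "'a::{real_inner, complete_space} \<Rightarrow> 'b::real_inner"
  assumes "bounded_linear B"
  shows "B x \<bullet> y = x \<bullet> adjoint B y"
proof -
  have "\<exists>z. \<forall>x. B x \<bullet> y = x \<bullet> z" for y
  proof -
    have "bounded_linear (\<lambda>x. B x \<bullet> y)"
      using bounded_linear_inner_left assms by (rule bounded_linear_compose)
    then show ?thesis using riesz_representation by (metis inner_commute)
  qed
  then have "\<exists>f. \<forall>x y. B x \<bullet> y = x \<bullet> f y" by metis
  then show ?thesis unfolding adjoint_def by (rule someI2_ex) blast
qed

lemma bounded_linear_adjoint:
  fixes B :: "'a::{real_inner, complete_space} \<Rightarrow> 'b::real_inner"
  assumes "bounded_linear B"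
  shows "bounded_linear (adjoint B)"
proof -
  interpret bounded_linear B by fact
  note adj = adjoint_inner[OF assms, symmetric]
  obtain K where "K > 0" and K: "\<And>x. norm (B x) \<le> norm x * K" using pos_bounded by blast
  show ?thesis
  proof (rule bounded_linear_intro[where K = K])
    fix u v and r :: real
    show "adjoint B (u + v) = adjoint B u + adjoint B v"
      by (subst vector_eq_ldot[symmetric]) (auto simp: adj inner_add_right)
    show "adjoint B (r *\<^sub>R u) = r *\<^sub>R adjoint B u"
      by (subst vector_eq_ldot[symmetric]) (auto simp: adj)
    \<comment> \<open>The adjoint equation is tested at \<open>x = adjoint B u\<close>; cancelling
      one factor gives the bound.\<close>
    have "norm (adjoint B u) * norm (adjoint B u) = B (adjoint B u) \<bullet> u"
      by (simp add: adjoint_inner[OF assms] power2_norm_eq_inner[symmetric] power2_eq_square)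
    also have "\<dots> \<le> norm (B (adjoint B u)) * norm u" by (rule norm_cauchy_schwarz)
    also have "\<dots> \<le> norm (adjoint B u) * K * norm u" using K by (intro mult_right_mono) auto
    finally have le: "norm (adjoint B u) * norm (adjoint B u) \<le> norm (adjoint B u) * (norm u * K)"
      by (simp add: mult_ac)
    show "norm (adjoint B u) \<le> norm u * K"
    proof (cases "adjoint B u = 0")
      case True
      then show ?thesis using \<open>K > 0\<close> by simp
    next
      case False
      then show ?thesis using le by simp
    qed
  qed
qed

text \<open>Sokal's gliding hump.\<close>

lemma weakly_bounded_imp_bounded:
  fixes W :: "'a::{real_inner, complete_space} set"
  assumes weak: "\<And>y. \<exists>C. \<forall>v\<in>W. \<bar>v \<bullet> y\<bar> \<le> C"
  shows "bounded W"
proof (rule ccontr)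
  assume "\<not> bounded W"
  then have "\<exists>v\<in>W. norm v \<ge> 4 ^ n" for n by (meson bounded_iff linear)
  then obtain v where vW: "\<And>n. v n \<in> W" and v: "\<And>n. norm (v n) \<ge> 4 ^ n" by metis
  \<comment> \<open>The point \<open>x\<close> is moved by a vector \<open>p\<close> of length
    \<open>(1/3)^n\<close> along \<open>v n\<close>. The values of \<open>v n\<close> at
    \<open>x + p\<close> and \<open>x - p\<close> differ by \<open>2 * (v n \<bullet> p)\<close>, so
    one of them is large.\<close>
  have step: "\<exists>x'. norm (x' - x) \<le> (1/3)^n \<and> \<bar>v n \<bullet> x'\<bar> \<ge> (1/3)^n * norm (v n)" for n :: nat and x
  proof -
    define p where "p = ((1/3)^n / norm (v n)) *\<^sub>R v n"
    have v0: "norm (v n) > 0" using v[of n] less_le_trans[of 0 "4^n" "norm (v n)"] by simp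
    have np: "norm p = (1/3)^n" using v0 by (simp add: p_def)
    have vp: "v n \<bullet> p = (1/3)^n * norm (v n)"
      using v0 by (simp add: p_def power2_norm_eq_inner[symmetric] power2_eq_square)
    have "v n \<bullet> (x + p) - v n \<bullet> (x - p) = 2 * (v n \<bullet> p)" by (simp add: inner_add_right inner_diff_right)
    then have "\<bar>v n \<bullet> (x + p)\<bar> \<ge> v n \<bullet> p \<or> \<bar>v n \<bullet> (x - p)\<bar> \<ge> v n \<bullet> p" by linarith
    then show ?thesis
    proof
      assume "\<bar>v n \<bullet> (x + p)\<bar> \<ge> v n \<bullet> p"
      then show ?thesis using np vp by (intro exI[of _ "x + p"]) simp
    next
      assume "\<bar>v n \<bullet> (x - p)\<bar> \<ge> v n \<bullet> p"
      then show ?thesis using np vp by (intro exI[of _ "x - p"]) simp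
    qed
  qed
  obtain x where x: "\<And>n. norm (x (Suc n) - x n) \<le> (1/3)^n"
    "\<And>n. \<bar>v n \<bullet> x (Suc n)\<bar> \<ge> (1/3)^n * norm (v n)"
  proof -
    define g where "g n x = (SOME x'. norm (x' - x) \<le> (1/3)^n \<and> \<bar>v n \<bullet> x'\<bar> \<ge> (1/3)^n * norm (v n))" for n x
    have g: "norm (g n x - x) \<le> (1/3)^n \<and> \<bar>v n \<bullet> g n x\<bar> \<ge> (1/3)^n * norm (v n)" for n x
      unfolding g_def using step by (rule someI_ex)
    show ?thesis by (rule that[of "rec_nat 0 g"]) (use g in auto)
  qed
  \<comment> \<open>The bound is the closed form of the geometric sum of the \<open>k\<close> moves
    from stage \<open>n\<close> on.\<close>
  have tail: "norm (x (n + k) - x n) \<le> (3/2) * (1/3)^n * (1 - (1/3)^k)" for n k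
  proof (induction k)
    case (Suc k)
    have "norm (x (n + Suc k) - x n) \<le> norm (x (Suc (n + k)) - x (n + k)) + norm (x (n + k) - x n)"
      using norm_triangle_ineq[of "x (Suc (n + k)) - x (n + k)" "x (n + k) - x n"] by simp
    also have "\<dots> \<le> (1/3)^(n + k) + (3/2) * (1/3)^n * (1 - (1/3)^k)" by (intro add_mono x Suc)
    also have "\<dots> = (3/2) * (1/3)^n * (1 - (1/3)^Suc k)" by (simp add: power_add field_simps)
    finally show ?case .
  qed simp
  have tail': "norm (x m - x n) \<le> (3/2) * (1/3)^n" if "n \<le> m" for m n
  proof -
    have "norm (x m - x n) \<le> (3/2) * (1/3)^n * (1 - (1/3)^(m - n))"
      using tail[of n "m - n"] that by (metis le_add_diff_inverse)
    also have "\<dots> \<le> (3/2) * (1/3)^n" by (rule mult_left_le) auto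
    finally show ?thesis .
  qed
  have "Cauchy x"
  proof (rule metric_CauchyI)
    fix e :: real assume "e > 0"
    have "(\<lambda>n. (3/2) * (1/3::real)^n) \<longlonglongrightarrow> 3/2 * 0"
      by (intro tendsto_intros LIMSEQ_power_zero) auto
    then have "\<forall>\<^sub>F n in sequentially. (3/2) * (1/3::real)^n < e"
      using \<open>e > 0\<close> by (intro order_tendstoD(2)) auto
    then obtain M where M: "\<And>n. n \<ge> M \<Longrightarrow> (3/2) * (1/3::real)^n < e"
      by (auto simp: eventually_sequentially)
    have "dist (x m) (x n) < e" if "m \<ge> M" "n \<ge> M" for m n
    proof (cases "m \<le> n")
      case True
      then show ?thesis
        using tail'[of m n] M[OF that(1)] by (simp add: dist_norm norm_minus_commute)
    next
      case False
      then show ?thesis using tail'[of n m] M[OF that(2)] by (simp add: dist_norm)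
    qed
    then show "\<exists>M. \<forall>m\<ge>M. \<forall>n\<ge>M. dist (x m) (x n) < e" by blast
  qed
  then obtain y where y: "x \<longlonglongrightarrow> y" using Cauchy_convergent convergent_def by blast
  have lim: "norm (y - x n) \<le> (3/2) * (1/3)^n" for n
  proof (rule LIMSEQ_le_const2)
    show "(\<lambda>m. norm (x m - x n)) \<longlonglongrightarrow> norm (y - x n)" using y by (intro tendsto_intros)
    show "\<exists>N. \<forall>m\<ge>N. norm (x m - x n) \<le> (3/2) * (1/3)^n" using tail' by blast
  qed
  obtain C where C: "\<And>n. \<bar>v n \<bullet> y\<bar> \<le> C" using weak vW by metis
  \<comment> \<open>All moves after stage \<open>n\<close> together change
    \<open>v n \<bullet> x (Suc n)\<close> by at most half of the
    \<open>(1/3)^n * norm (v n)\<close> secured there. The other half survives in the limit and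
    grows like \<open>(4/3)^n\<close>.\<close>
  have le_C: "(1/2) * (4/3)^n \<le> C" for n
  proof -
    have "\<bar>v n \<bullet> (y - x (Suc n))\<bar> \<le> norm (v n) * norm (y - x (Suc n))"
      by (rule Cauchy_Schwarz_ineq2)
    also have "\<dots> \<le> norm (v n) * ((1/2) * (1/3)^n)"
      using lim[of "Suc n"] by (intro mult_left_mono) auto
    finally have "\<bar>v n \<bullet> y\<bar> \<ge> (1/2) * ((1/3)^n * norm (v n))"
      using x(2)[of n] unfolding inner_diff_right mult.commute[of "norm (v n)"] by linarith
    moreover have "(1/3)^n * norm (v n) \<ge> (1/3)^n * 4^n" using v by (intro mult_left_mono) auto
    moreover have "(1/3)^n * 4^n = (4/3::real)^n" by (simp add: power_mult_distrib[symmetric])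
    ultimately show ?thesis using C[of n] by linarith
  qed
  obtain n where n: "(4/3::real)^n > 2 * C" using real_arch_pow[of "4/3"] by auto
  then show False using le_C[of n] by simp
qed

lemma surj_iff_adjoint_bounded_below:
  fixes B :: "'a::{real_inner, complete_space} \<Rightarrow> 'a"
  assumes "bounded_linear B"
  shows "surj B \<longleftrightarrow> (\<exists>\<epsilon>>0. \<forall>v. norm (adjoint B v) \<ge> \<epsilon> * norm v)"
proof
  note adj = adjoint_inner[OF assms]
  interpret adj: bounded_linear "adjoint B" by (rule bounded_linear_adjoint[OF assms])
  assume "surj B"
  define W where "W = {v. norm (adjoint B v) \<le> 1}"
  have "\<exists>C. \<forall>v\<in>W. \<bar>v \<bullet> y\<bar> \<le> C" for y
  proof -
    obtain x where x: "y = B x" using \<open>surj B\<close> by blast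
    have "\<bar>v \<bullet> y\<bar> \<le> norm x" if "v \<in> W" for v
    proof -
      have "\<bar>v \<bullet> y\<bar> \<le> norm (adjoint B v) * norm x"
        unfolding x by (metis adj inner_commute Cauchy_Schwarz_ineq2)
      also have "\<dots> \<le> 1 * norm x" using that by (intro mult_right_mono) (auto simp: W_def)
      finally show ?thesis by simp
    qed
    then show ?thesis by blast
  qed
  then have "bounded W" by (rule weakly_bounded_imp_bounded)
  then obtain C where C: "C > 0" "\<And>v. v \<in> W \<Longrightarrow> norm v \<le> C" by (auto simp: bounded_pos)
  \<comment> \<open>Scaling a vector into \<open>W\<close> divides by
    \<open>norm (adjoint B v)\<close>, which must not vanish.\<close>
  have inj: "v = 0" if "adjoint B v = 0" for v
  proof -
    obtain x where "v = B x" using \<open>surj B\<close> by blast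
    then have "v \<bullet> v = x \<bullet> adjoint B v" by (metis adj)
    then show ?thesis using that by simp
  qed
  have "norm v \<le> C * norm (adjoint B v)" for v
  proof (cases "v = 0")
    case False
    let ?a = "norm (adjoint B v)"
    have a: "?a > 0" using inj False by auto
    then have "(1 / ?a) *\<^sub>R v \<in> W" by (simp add: W_def adj.scaleR)
    from C(2)[OF this] a show ?thesis by (simp add: field_simps)
  qed (simp add: adj.zero)
  then have "norm (adjoint B v) \<ge> (1 / C) * norm v" for v using C by (simp add: field_simps)
  then show "\<exists>\<epsilon>>0. \<forall>v. norm (adjoint B v) \<ge> \<epsilon> * norm v" using C by (intro exI[of _ "1/C"]) auto
next
  assume "\<exists>\<epsilon>>0. \<forall>v. norm (adjoint B v) \<ge> \<epsilon> * norm v"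
  then obtain \<epsilon> where \<epsilon>: "\<epsilon> > 0" "\<And>v. norm (adjoint B v) \<ge> \<epsilon> * norm v" by blast
  have "surj (\<lambda>v. B (adjoint B v))"
  proof (rule coercive_surj)
    show "bounded_linear (\<lambda>v. B (adjoint B v))"
      using assms bounded_linear_adjoint[OF assms] by (rule bounded_linear_compose)
    show "\<epsilon>\<^sup>2 > 0" using \<epsilon> by simp
    fix v
    have "\<epsilon>\<^sup>2 * (norm v)\<^sup>2 \<le> (norm (adjoint B v))\<^sup>2"
      using power_mono[OF \<epsilon>(2)[of v], of 2] \<epsilon>(1) by (simp add: power_mult_distrib)
    then show "\<epsilon>\<^sup>2 * (norm v)\<^sup>2 \<le> B (adjoint B v) \<bullet> v"
      by (simp add: adjoint_inner[OF assms] power2_norm_eq_inner)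
  qed
  then show "surj B" unfolding surj_def by blast
qed

section \<open>Calculus for functions with values in a Hilbert space\<close>

text \<open>Turns an estimate tested against the vector itself into a norm bound by cancelling one
  factor \<open>norm w\<close>.\<close>

lemma norm_le_if_inner_le:
  fixes w :: "'a::real_inner"
  assumes "w \<bullet> w \<le> K * norm w" "0 \<le> K"
  shows "norm w \<le> K"
proof (cases "w = 0")
  case False
  have "norm w * norm w \<le> K * norm w"
    using assms(1) by (simp add: power2_norm_eq_inner[symmetric] power2_eq_square)
  then show ?thesis using False by simp
qed (use assms in simp)

text \<open>Testing against the error vector \<open>w\<close> itself reduces the claim to the real
  mean value inequality. The comparison vector \<open>c\<close> is free: \<open>c = 0\<close> gives
  Lipschitz bounds, \<open>c = g t\<close> differentiability.\<close>

lemma weak_derivative_mean_value: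
  fixes u g :: "real \<Rightarrow> 'a::real_inner"
  assumes weak: "\<And>r y. r \<in> S \<Longrightarrow> ((\<lambda>r. u r \<bullet> y) has_real_derivative g r \<bullet> y) (at r within S)"
    and seg: "closed_segment t s \<subseteq> S"
    and bound: "\<And>r. r \<in> closed_segment t s \<Longrightarrow> norm (g r - c) \<le> e"
  shows "norm (u s - u t - (s - t) *\<^sub>R c) \<le> e * \<bar>s - t\<bar>"
proof (rule norm_le_if_inner_le)
  have e: "0 \<le> e" using order_trans[OF norm_ge_zero bound[of t]] by simp
  then show "0 \<le> e * \<bar>s - t\<bar>" by simp
  define w where "w = u s - u t - (s - t) *\<^sub>R c"
  define \<phi> where "\<phi> r = u r \<bullet> w - r * (c \<bullet> w)" for r
  have "norm (\<phi> s - \<phi> t) \<le> (e * norm w) * norm (s - t)"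
  proof (rule field_differentiable_bound[where S = "closed_segment t s" and f' = "\<lambda>r. (g r - c) \<bullet> w"])
    fix r assume r: "r \<in> closed_segment t s"
    have "((\<lambda>r. u r \<bullet> w) has_real_derivative g r \<bullet> w) (at r within closed_segment t s)"
      using weak seg r by (meson DERIV_subset subsetD)
    then show "(\<phi> has_field_derivative (g r - c) \<bullet> w) (at r within closed_segment t s)"
      unfolding \<phi>_def by (auto intro!: derivative_eq_intros simp: inner_diff_left)
    have "\<bar>(g r - c) \<bullet> w\<bar> \<le> norm (g r - c) * norm w" by (rule Cauchy_Schwarz_ineq2)
    also have "\<dots> \<le> e * norm w" using bound[OF r] by (rule mult_right_mono) simp
    finally show "norm ((g r - c) \<bullet> w) \<le> e * norm w" by simp
  qed auto
  moreover have "\<phi> s - \<phi> t = w \<bullet> w" by (simp add: \<phi>_def w_def algebra_simps)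
  ultimately have "w \<bullet> w \<le> e * norm w * \<bar>s - t\<bar>" by simp
  then show "(u s - u t - (s - t) *\<^sub>R c) \<bullet> (u s - u t - (s - t) *\<^sub>R c)
      \<le> e * \<bar>s - t\<bar> * norm (u s - u t - (s - t) *\<^sub>R c)"
    unfolding w_def by (simp add: mult_ac)
qed

text \<open>The mean value estimate with \<open>c = g t\<close> is uniform over test vectors, and
  continuity of \<open>g\<close> at \<open>t\<close> makes its error factor arbitrarily
  small.\<close>

lemma weak_derivative_imp_has_vector_derivative:
  fixes u g :: "real \<Rightarrow> 'a::real_inner"
  assumes weak: "\<And>r y. r \<in> S \<Longrightarrow> ((\<lambda>r. u r \<bullet> y) has_real_derivative g r \<bullet> y) (at r within S)"
    and "convex S" "t \<in> S" and cont: "continuous (at t within S) g"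
  shows "(u has_vector_derivative g t) (at t within S)"
  unfolding has_vector_derivative_def has_derivative_within_alt
proof (intro conjI allI impI)
  show "bounded_linear (\<lambda>x. x *\<^sub>R g t)" by (rule bounded_linear_scaleR_left)
  fix e :: real assume "e > 0"
  then obtain d where d: "d > 0" "\<And>r. r \<in> S \<Longrightarrow> dist r t < d \<Longrightarrow> dist (g r) (g t) < e"
    using cont unfolding continuous_within_eps_delta by metis
  show "\<exists>d>0. \<forall>s\<in>S. norm (s - t) < d \<longrightarrow> norm (u s - u t - (s - t) *\<^sub>R g t) \<le> e * norm (s - t)"
  proof (intro exI conjI ballI impI)
    show "d > 0" by fact
    fix s assume s: "s \<in> S" "norm (s - t) < d"
    have seg: "closed_segment t s \<subseteq> S" using assms s by (simp add: closed_segment_subset)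
    have "norm (u s - u t - (s - t) *\<^sub>R g t) \<le> e * \<bar>s - t\<bar>"
    proof (rule weak_derivative_mean_value[OF weak seg])
      fix r assume r: "r \<in> closed_segment t s"
      then have "norm (r - t) \<le> norm (s - t)" using segment_bound(1)[OF r] by simp
      then show "norm (g r - g t) \<le> e"
        using d(2)[of r] s seg r by (auto simp: dist_norm intro!: less_imp_le)
    qed
    then show "norm (u s - u t - (s - t) *\<^sub>R g t) \<le> e * norm (s - t)" by simp
  qed
qed

section \<open>Primitives and linear differential equations\<close>

text \<open>For fixed \<open>t\<close> the real integral of \<open>f s \<bullet> y\<close> over
  \<open>{0..t}\<close> is a bounded functional of \<open>y\<close>, and \<open>F t\<close> is its
  Riesz vector. Continuity of \<open>f\<close> upgrades the weak derivative to a strong one.\<close>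

lemma primitive_exists:
  fixes f :: "real \<Rightarrow> 'a::{real_inner, complete_space}"
  assumes cont: "continuous_on {0..T} f" and "0 \<le> T"
  obtains F where "F 0 = 0"
    "\<And>t. t \<in> {0..T} \<Longrightarrow> (F has_vector_derivative f t) (at t within {0..T})"
proof -
  have "bounded (f ` {0..T})" using cont by (intro compact_imp_bounded compact_continuous_image) auto
  then obtain M where M: "M > 0" "\<And>s. s \<in> {0..T} \<Longrightarrow> norm (f s) \<le> M"
    by (auto simp: bounded_pos)
  have conty: "continuous_on {0..T} (\<lambda>s. f s \<bullet> y)" for y by (intro continuous_intros cont)
  have "\<exists>z. \<forall>y. integral {0..t} (\<lambda>s. f s \<bullet> y) = z \<bullet> y" if t: "t \<in> {0..T}" for t
  proof -
    have int: "(\<lambda>s. f s \<bullet> y) integrable_on {0..t}" for y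
      using t by (intro integrable_continuous_real continuous_on_subset[OF conty]) auto
    have "bounded_linear (\<lambda>y. integral {0..t} (\<lambda>s. f s \<bullet> y))"
    proof (rule bounded_linear_intro[where K = "M * t"])
      fix y z and r :: real
      show "integral {0..t} (\<lambda>s. f s \<bullet> (y + z)) = integral {0..t} (\<lambda>s. f s \<bullet> y) + integral {0..t} (\<lambda>s. f s \<bullet> z)"
        by (simp add: inner_add_right integral_add int)
      show "integral {0..t} (\<lambda>s. f s \<bullet> (r *\<^sub>R y)) = r *\<^sub>R integral {0..t} (\<lambda>s. f s \<bullet> y)"
        by simp
      have "norm (integral {0..t} (\<lambda>s. f s \<bullet> y)) \<le> integral {0..t} (\<lambda>s. M * norm y)"
      proof (rule integral_norm_bound_integral[OF int])
        fix s assume "s \<in> {0..t}"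
        have "\<bar>f s \<bullet> y\<bar> \<le> norm (f s) * norm y" by (rule Cauchy_Schwarz_ineq2)
        also have "\<dots> \<le> M * norm y" using M(2) \<open>s \<in> {0..t}\<close> t by (intro mult_right_mono) auto
        finally show "norm (f s \<bullet> y) \<le> M * norm y" by simp
      qed (rule integrable_const_ivl)
      then show "norm (integral {0..t} (\<lambda>s. f s \<bullet> y)) \<le> norm y * (M * t)"
        using t by (simp add: mult_ac)
    qed
    from riesz_representation[OF this] show ?thesis by blast
  qed
  then obtain F where F: "\<And>t y. t \<in> {0..T} \<Longrightarrow> integral {0..t} (\<lambda>s. f s \<bullet> y) = F t \<bullet> y"
    by metis
  have deriv: "((\<lambda>t. F t \<bullet> y) has_real_derivative f t \<bullet> y) (at t within {0..T})"
    if t: "t \<in> {0..T}" for t y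
  proof -
    have "((\<lambda>t. integral {0..t} (\<lambda>s. f s \<bullet> y)) has_real_derivative f t \<bullet> y) (at t within {0..T})"
      using conty t by (rule integral_has_real_derivative)
    then show ?thesis
      unfolding has_field_derivative_def
      by (rule has_derivative_transform_within[OF _ zero_less_one t]) (use F in auto)
  qed
  show ?thesis
  proof (rule that)
    show "F 0 = 0" using F[of 0 "F 0"] assms(2) by simp
    fix t assume t: "t \<in> {0..T}"
    show "(F has_vector_derivative f t) (at t within {0..T})"
      using t cont by (intro weak_derivative_imp_has_vector_derivative[OF deriv])
        (auto simp: continuous_on_eq_continuous_within)
  qed
qed

text \<open>The solution is the exponential series with terms
  \<open>(t ^ n / fact n) *\<^sub>R (B ^^ n) x\<close>, summed weakly: paired with \<open>y\<close>
  it is a real power series dominated by an exponential, and Riesz representation turns its sums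
  into vectors \<open>u t\<close>.\<close>

lemma linear_ode_solution_exists:
  fixes B :: "'a::{real_inner, complete_space} \<Rightarrow> 'a"
  assumes "bounded_linear B"
  obtains u where "u 0 = x" "\<And>t. (u has_vector_derivative B (u t)) (at t)"
proof -
  interpret bounded_linear B by fact
  obtain K where K: "K > 0" "\<And>x. norm (B x) \<le> norm x * K" using pos_bounded by blast
  have pow: "norm ((B ^^ n) x) \<le> K ^ n * norm x" for n
  proof (induction n)
    case (Suc n)
    have "norm ((B ^^ Suc n) x) \<le> norm ((B ^^ n) x) * K" using K(2) by simp
    also have "\<dots> \<le> (K ^ n * norm x) * K" using Suc K(1) by (intro mult_right_mono) auto
    finally show ?case by (simp add: mult_ac)
  qed simp
  define c where "c y n = ((B ^^ n) x \<bullet> y) / fact n" for y n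
  have c_bound: "norm (c y n * t ^ n) \<le> (norm x * norm y) * (inverse (fact n) * (K * \<bar>t\<bar>) ^ n)" for y n t
  proof -
    have "\<bar>(B ^^ n) x \<bullet> y\<bar> \<le> (K ^ n * norm x) * norm y"
      by (rule order_trans[OF Cauchy_Schwarz_ineq2 mult_right_mono[OF pow]]) simp
    then have "\<bar>(B ^^ n) x \<bullet> y\<bar> * (\<bar>t\<bar> ^ n / fact n) \<le> ((K ^ n * norm x) * norm y) * (\<bar>t\<bar> ^ n / fact n)"
      by (rule mult_right_mono) simp
    then show ?thesis by (simp add: c_def abs_mult power_abs power_mult_distrib field_simps)
  qed
  have exp_sums: "(\<lambda>n. (norm x * norm y) * (inverse (fact n) * (K * \<bar>t\<bar>) ^ n)) sums
      ((norm x * norm y) * exp (K * \<bar>t\<bar>))" for y t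
    using sums_mult[OF exp_converges[of "K * \<bar>t\<bar>"]] by simp
  have summ: "summable (\<lambda>n. c y n * t ^ n)" for y t
    using summable_comparison_test'[OF sums_summable[OF exp_sums], of 0 "\<lambda>n. c y n * t ^ n"] c_bound
    by blast
  have bound: "\<bar>\<Sum>n. c y n * t ^ n\<bar> \<le> norm y * (norm x * exp (K * \<bar>t\<bar>))" for y t
  proof -
    have "norm (\<Sum>n. c y n * t ^ n) \<le> (norm x * norm y) * exp (K * \<bar>t\<bar>)"
      using norm_suminf_le[OF c_bound sums_summable[OF exp_sums]] sums_unique[OF exp_sums] by metis
    then show ?thesis by (simp add: mult_ac)
  qed
  have "\<exists>z. \<forall>y. (\<Sum>n. c y n * t ^ n) = z \<bullet> y" for t
  proof -
    have "bounded_linear (\<lambda>y. \<Sum>n. c y n * t ^ n)"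
    proof (rule bounded_linear_intro[where K = "norm x * exp (K * \<bar>t\<bar>)"])
      fix y z and r :: real
      have "(\<Sum>n. c y n * t ^ n) + (\<Sum>n. c z n * t ^ n) = (\<Sum>n. c y n * t ^ n + c z n * t ^ n)"
        by (rule suminf_add[OF summ summ])
      then show "(\<Sum>n. c (y + z) n * t ^ n) = (\<Sum>n. c y n * t ^ n) + (\<Sum>n. c z n * t ^ n)"
        by (simp add: c_def inner_add_right add_divide_distrib distrib_right)
      show "(\<Sum>n. c (r *\<^sub>R y) n * t ^ n) = r *\<^sub>R (\<Sum>n. c y n * t ^ n)"
        using suminf_mult[OF summ, of r y t] by (simp add: c_def mult_ac)
      show "norm (\<Sum>n. c y n * t ^ n) \<le> norm y * (norm x * exp (K * \<bar>t\<bar>))"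
        using bound by simp
    qed
    from riesz_representation[OF this] show ?thesis by blast
  qed
  then obtain u where u: "\<And>t y. (\<Sum>n. c y n * t ^ n) = u t \<bullet> y" by metis
  \<comment> \<open>Differentiating the power series shifts its coefficients by one, which moves one
    factor \<open>B\<close> across the inner product; hence the weak derivative of \<open>u\<close>
    is \<open>B (u t)\<close>.\<close>
  have diffs_c: "diffs (c y) n = c (adjoint B y) n" for y n
    by (simp add: diffs_def c_def adjoint_inner[OF assms, symmetric] field_simps del: of_nat_Suc)
  have weak: "((\<lambda>t. u t \<bullet> y) has_real_derivative B (u t) \<bullet> y) (at t)" for t y
    using termdiffs_strong_converges_everywhere[of "c y" t] summ
    by (simp add: diffs_c u adjoint_inner[OF assms, symmetric])
  have u_bound: "norm (u t) \<le> norm x * exp (K * \<bar>t\<bar>)" for t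
    using bound[of "u t" t] unfolding u by (intro norm_le_if_inner_le) (simp_all add: mult.commute)
  \<comment> \<open>A local Lipschitz bound from the case \<open>c = 0\<close>. It makes
    \<open>u\<close>, hence also its weak derivative, continuous, as the upgrade to a strong
    derivative demands.\<close>
  have lip: "norm (u s - u t) \<le> (norm x * exp (K * (\<bar>t\<bar> + 1)) * K) * \<bar>s - t\<bar>" if "\<bar>s - t\<bar> < 1" for s t
  proof -
    have "norm (u s - u t - (s - t) *\<^sub>R 0) \<le> (norm x * exp (K * (\<bar>t\<bar> + 1)) * K) * \<bar>s - t\<bar>"
    proof (rule weak_derivative_mean_value[where S = UNIV and g = "\<lambda>t. B (u t)"])
      fix r assume "r \<in> closed_segment t s"
      then have "\<bar>r - t\<bar> \<le> \<bar>s - t\<bar>" using segment_bound(1) by fastforce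
      then have r: "\<bar>r\<bar> \<le> \<bar>t\<bar> + 1" using that by linarith
      have "norm (B (u r)) \<le> norm (u r) * K" by (rule K)
      also have "\<dots> \<le> (norm x * exp (K * \<bar>r\<bar>)) * K" using u_bound K by (intro mult_right_mono) auto
      also have "\<dots> \<le> (norm x * exp (K * (\<bar>t\<bar> + 1))) * K"
        using r K by (intro mult_right_mono mult_left_mono) auto
      finally show "norm (B (u r) - 0) \<le> norm x * exp (K * (\<bar>t\<bar> + 1)) * K" by simp
    qed (use weak in auto)
    then show ?thesis by simp
  qed
  have cont: "isCont u t" for t
    unfolding isCont_def
  proof (rule LIM_I)
    fix e :: real assume "e > 0"
    \<comment> \<open>The added 1 keeps \<open>L\<close> positive when \<open>x = 0\<close>, so that
      dividing by it is legitimate.\<close>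
    define L where "L = norm x * exp (K * (\<bar>t\<bar> + 1)) * K + 1"
    have L: "L > 0" using K by (auto simp: L_def intro!: add_nonneg_pos)
    show "\<exists>d>0. \<forall>s. s \<noteq> t \<and> norm (s - t) < d \<longrightarrow> norm (u s - u t) < e"
    proof (intro exI[of _ "min 1 (e / L)"] conjI allI impI)
      show "0 < min 1 (e / L)" using L \<open>e > 0\<close> by simp
      fix s assume s: "s \<noteq> t \<and> norm (s - t) < min 1 (e / L)"
      have "norm (u s - u t) \<le> (L - 1) * \<bar>s - t\<bar>" using lip[of s t] s by (simp add: L_def)
      also have "\<dots> \<le> L * \<bar>s - t\<bar>" by (intro mult_right_mono) auto
      also have "\<dots> < e" using s L by (simp add: field_simps)
      finally show "norm (u s - u t) < e" .
    qed
  qed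
  show ?thesis
  proof (rule that)
    show "u 0 = x"
    proof (rule vector_eq_ldot[THEN iffD1], rule allI)
      fix y
      have "(\<Sum>n. c y n * 0 ^ n) = c y 0" using powser_zero[of "c y"] by simp
      then show "y \<bullet> u 0 = y \<bullet> x" using u[of y 0] by (simp add: c_def inner_commute)
    qed
    fix t
    have "isCont (\<lambda>t. B (u t)) t" using cont by (rule isCont)
    then show "(u has_vector_derivative B (u t)) (at t)"
      by (intro weak_derivative_imp_has_vector_derivative[OF weak]) auto
  qed
qed

text \<open>The derivative of \<open>u t \<bullet> u t\<close> is
  \<open>2 * (B (u t) \<bullet> u t) \<le> 0\<close>. Applied to one solution this gives
  contractivity; applied to a difference of two it gives uniqueness.\<close>

lemma dissipative_ode_norm_le:
  fixes B :: "'a::real_inner \<Rightarrow> 'a"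
  assumes diss: "\<And>x. B x \<bullet> x \<le> 0"
    and u: "\<And>t. (u has_vector_derivative B (u t)) (at t)" and "0 \<le> t"
  shows "norm (u t) \<le> norm (u 0)"
proof (rule power2_le_imp_le)
  have "u t \<bullet> u t \<le> u 0 \<bullet> u 0"
  proof (rule DERIV_nonpos_imp_nonincreasing[OF \<open>0 \<le> t\<close>])
    fix s
    have "((\<lambda>s. u s \<bullet> u s) has_real_derivative 2 * (B (u s) \<bullet> u s)) (at s)"
      using bounded_bilinear.has_vector_derivative[OF bounded_bilinear_inner u u, of s]
      by (simp add: has_real_derivative_iff_has_vector_derivative inner_commute)
    then show "\<exists>y. ((\<lambda>s. u s \<bullet> u s) has_real_derivative y) (at s) \<and> y \<le> 0"
      using diss[of "u s"] by (intro exI[of _ "2 * (B (u s) \<bullet> u s)"]) simp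
  qed
  then show "(norm (u t))\<^sup>2 \<le> (norm (u 0))\<^sup>2" by (simp add: power2_norm_eq_inner)
qed simp

section \<open>Necessity in the Lumer--Phillips theorem\<close>

text \<open>The graph of the generator as a relation: lying in the domain means being related to
  some \<open>y\<close>, and no \<open>Lim\<close> of a possibly divergent quotient occurs.\<close>

definition generator_limit :: "(real \<Rightarrow> 'a::real_normed_vector \<Rightarrow>\<^sub>L 'a) \<Rightarrow> 'a \<Rightarrow> 'a \<Rightarrow> bool" where
  "generator_limit S x y \<longleftrightarrow> ((\<lambda>t. (1 / t) *\<^sub>R (S t x - x)) \<longlongrightarrow> y) (at_right 0)"

lemma is_generator_iff:
  "is_generator D A S \<longleftrightarrow>
    (\<forall>x\<in>D. generator_limit S x (A x)) \<and> (\<forall>x y. generator_limit S x y \<longrightarrow> x \<in> D)"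
proof -
  have dom: "generator_domain S = {x. \<exists>y. generator_limit S x y}"
    by (simp add: generator_domain_def generator_limit_def blinfun.diff_left id_blinfun.rep_eq)
  have gen: "generator S x = y" if "generator_limit S x y" for x y
    using that by (auto simp: generator_def generator_limit_def blinfun.diff_left id_blinfun.rep_eq
        intro!: tendsto_Lim)
  show ?thesis
  proof
    assume l: "is_generator D A S"
    then have D: "D = {x. \<exists>y. generator_limit S x y}" by (simp add: is_generator_def dom)
    have "generator_limit S x (A x)" if "x \<in> D" for x
    proof -
      have "\<exists>y. generator_limit S x y" using that D by blast
      then obtain y where y: "generator_limit S x y" by blast
      have "A x = generator S x" using l that by (simp add: is_generator_def)
      then show ?thesis using y gen[OF y] by simp
    qed
    with D show "(\<forall>x\<in>D. generator_limit S x (A x)) \<and> (\<forall>x y. generator_limit S x y \<longrightarrow> x \<in> D)"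
      by blast
  next
    assume "(\<forall>x\<in>D. generator_limit S x (A x)) \<and> (\<forall>x y. generator_limit S x y \<longrightarrow> x \<in> D)"
    then show "is_generator D A S" unfolding is_generator_def dom using gen by blast
  qed
qed

text \<open>The product rule at 0 for \<open>exp (- c * t)\<close> and the orbit. Rescaling moves
  the rate \<open>\<omega>\<close> to 0 for dissipativity and to -1 for the range condition, and
  returns from 0 to \<open>\<omega>\<close> after the construction.\<close>

lemma generator_limit_rescale:
  fixes S :: "real \<Rightarrow> 'a::real_normed_vector \<Rightarrow>\<^sub>L 'a"
  assumes "generator_limit S x y"
  shows "generator_limit (\<lambda>t. exp (- c * t) *\<^sub>R S t) x (y - c *\<^sub>R x)"
proof -
  have "((\<lambda>t. exp (- c * t)) has_real_derivative - c) (at 0 within {0<..})"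
    by (auto intro!: derivative_eq_intros)
  then have "((\<lambda>t. (exp (- c * t) - 1) / t) \<longlongrightarrow> - c) (at_right 0)"
    unfolding has_field_derivative_iff by simp
  moreover have "((\<lambda>t. exp (- c * t)) \<longlongrightarrow> 1) (at_right 0)"
    by (auto intro!: tendsto_eq_intros)
  moreover have "((\<lambda>t. (1 / t) *\<^sub>R (S t x - x)) \<longlongrightarrow> y) (at_right 0)"
    using assms by (simp add: generator_limit_def)
  ultimately have "((\<lambda>t. exp (- c * t) *\<^sub>R ((1 / t) *\<^sub>R (S t x - x)) + ((exp (- c * t) - 1) / t) *\<^sub>R x)
      \<longlongrightarrow> 1 *\<^sub>R y + (- c) *\<^sub>R x) (at_right 0)"
    by (intro tendsto_intros)
  moreover have "exp (- c * t) *\<^sub>R ((1 / t) *\<^sub>R (S t x - x)) + ((exp (- c * t) - 1) / t) *\<^sub>R x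
      = (1 / t) *\<^sub>R ((exp (- c * t) *\<^sub>R S t) x - x)" for t
  proof -
    have "((exp (- c * t) - 1) / t) *\<^sub>R x = (1 / t) *\<^sub>R (exp (- c * t) *\<^sub>R x - x)"
      by (simp add: scaleR_diff_left scaleR_diff_right diff_divide_distrib)
    then show ?thesis by (simp add: blinfun.scaleR_left scaleR_diff_right)
  qed
  ultimately show ?thesis by (simp add: generator_limit_def)
qed

lemma is_generator_rescale:
  assumes "is_generator D A S"
  shows "is_generator D (\<lambda>x. A x - c *\<^sub>R x) (\<lambda>t. exp (- c * t) *\<^sub>R S t)"
  unfolding is_generator_iff
proof (intro conjI ballI allI impI)
  fix x assume "x \<in> D"
  then show "generator_limit (\<lambda>t. exp (- c * t) *\<^sub>R S t) x (A x - c *\<^sub>R x)"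
    using assms unfolding is_generator_iff by (blast intro: generator_limit_rescale)
next
  fix x y assume "generator_limit (\<lambda>t. exp (- c * t) *\<^sub>R S t) x y"
  \<comment> \<open>Rescaling back with \<open>- c\<close> undoes the first rescaling, so the domain
    cannot grow.\<close>
  from generator_limit_rescale[OF this, of "- c"] have "generator_limit S x (y + c *\<^sub>R x)"
    by (simp flip: exp_add)
  then show "x \<in> D" using assms unfolding is_generator_iff by blast
qed

lemma quasicontraction_semigroup_rescale:
  assumes "quasicontraction_semigroup \<omega> S"
  shows "quasicontraction_semigroup (\<omega> - c) (\<lambda>t. exp (- c * t) *\<^sub>R S t)"
  unfolding quasicontraction_semigroup_def C0_semigroup_def
proof (intro conjI allI impI)
  have S: "S 0 = id_blinfun" "\<And>t s. t \<ge> 0 \<Longrightarrow> s \<ge> 0 \<Longrightarrow> S (t + s) = S t o\<^sub>L S s"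
    "\<And>x. ((\<lambda>t. S t x) \<longlongrightarrow> x) (at_right 0)" "\<And>t. t \<ge> 0 \<Longrightarrow> norm (S t) \<le> exp (\<omega> * t)"
    using assms by (auto simp: quasicontraction_semigroup_def C0_semigroup_def)
  show "exp (- c * 0) *\<^sub>R S 0 = id_blinfun" by (simp add: S)
  fix t :: real
  show "norm (exp (- c * t) *\<^sub>R S t) \<le> exp ((\<omega> - c) * t)" if "0 \<le> t"
  proof -
    have "norm (exp (- c * t) *\<^sub>R S t) \<le> exp (- c * t) * exp (\<omega> * t)"
      using S(4)[OF that] by simp
    then show ?thesis by (simp add: algebra_simps flip: exp_add)
  qed
  show "exp (- c * (t + s)) *\<^sub>R S (t + s) = exp (- c * t) *\<^sub>R S t o\<^sub>L exp (- c * s) *\<^sub>R S s"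
    if "0 \<le> t" "0 \<le> s" for s
  proof (rule blinfun_eqI)
    fix x
    have "exp (- c * (t + s)) = exp (- c * t) * exp (- c * s)"
      by (simp add: algebra_simps flip: exp_add)
    then show "(exp (- c * (t + s)) *\<^sub>R S (t + s)) x = (exp (- c * t) *\<^sub>R S t o\<^sub>L exp (- c * s) *\<^sub>R S s) x"
      by (simp add: S(2)[OF that] blinfun.scaleR_left blinfun.scaleR_right)
  qed
  fix x
  have "((\<lambda>t. exp (- c * t) *\<^sub>R S t x) \<longlongrightarrow> 1 *\<^sub>R x) (at_right 0)"
    by (intro tendsto_scaleR S(3)) (auto intro!: tendsto_eq_intros)
  then show "((\<lambda>t. (exp (- c * t) *\<^sub>R S t) x) \<longlongrightarrow> x) (at_right 0)"
    by (simp add: blinfun.scaleR_left)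
qed

section \<open>Dissipativity and range of a generator\<close>

text \<open>By Cauchy-Schwarz \<open>x \<bullet> S t x \<le> x \<bullet> x\<close>, so every
  difference quotient pairs nonpositively with \<open>x\<close>. The form with a bare limit
  \<open>y\<close> also serves later to show that a constructed generator has no larger domain than
  \<open>D\<close>.\<close>

lemma contraction_generator_limit_dissipative:
  fixes S :: "real \<Rightarrow> 'a::real_inner \<Rightarrow>\<^sub>L 'a"
  assumes contr: "\<And>t. t \<ge> 0 \<Longrightarrow> norm (S t) \<le> 1" and lim: "generator_limit S x y"
  shows "x \<bullet> y \<le> 0"
proof (rule tendsto_upperbound)
  show "((\<lambda>t. x \<bullet> ((1 / t) *\<^sub>R (S t x - x))) \<longlongrightarrow> x \<bullet> y) (at_right 0)"
    using lim unfolding generator_limit_def by (intro tendsto_intros)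
  have "x \<bullet> ((1 / t) *\<^sub>R (S t x - x)) \<le> 0" if "t > 0" for t
  proof -
    have "x \<bullet> S t x \<le> norm x * norm (S t x)" by (rule norm_cauchy_schwarz)
    also have "\<dots> \<le> norm x * (1 * norm x)"
      using that contr[of t] norm_blinfun[of "S t" x]
      by (intro mult_left_mono order_trans[OF norm_blinfun] mult_right_mono) auto
    finally have "x \<bullet> (S t x - x) \<le> 0"
      by (simp add: inner_diff_right power2_norm_eq_inner[symmetric] power2_eq_square)
    then show ?thesis using that by (simp add: divide_nonpos_pos)
  qed
  then show "\<forall>\<^sub>F t in at_right 0. x \<bullet> ((1 / t) *\<^sub>R (S t x - x)) \<le> 0"
    by (auto simp: eventually_at_right_less eventually_at_filter)
qed simp

lemma generator_dissipative:
  fixes S :: "real \<Rightarrow> 'a::real_inner \<Rightarrow>\<^sub>L 'a"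
  assumes S: "quasicontraction_semigroup \<omega> S" "is_generator D A S" and "x \<in> D"
  shows "x \<bullet> A x \<le> \<omega> * (x \<bullet> x)"
proof -
  have "x \<bullet> (A x - \<omega> *\<^sub>R x) \<le> 0"
  proof (rule contraction_generator_limit_dissipative)
    show "generator_limit (\<lambda>t. exp (- \<omega> * t) *\<^sub>R S t) x (A x - \<omega> *\<^sub>R x)"
      using is_generator_rescale[OF S(2), of \<omega>] \<open>x \<in> D\<close> by (simp add: is_generator_iff)
    show "norm (exp (- \<omega> * t) *\<^sub>R S t) \<le> 1" if "t \<ge> 0" for t
      using quasicontraction_semigroup_rescale[OF S(1), of \<omega>] that
      by (simp add: quasicontraction_semigroup_def)
  qed
  then show ?thesis by (simp add: inner_diff_right)
qed

text \<open>The semigroup law and contractivity bound the increment from \<open>s\<close> to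
  \<open>t\<close> by the increment from 0 to \<open>t - s\<close>, so the limit at 0 controls
  continuity everywhere, from both sides.\<close>

lemma contraction_orbit_continuous:
  fixes S :: "real \<Rightarrow> 'a::real_normed_vector \<Rightarrow>\<^sub>L 'a"
  assumes "C0_semigroup S" and contr: "\<And>t. t \<ge> 0 \<Longrightarrow> norm (S t) \<le> 1"
  shows "continuous_on {0..} (\<lambda>t. S t x)"
  unfolding continuous_on_iff
proof (intro ballI allI impI)
  have S: "\<And>t s. t \<ge> 0 \<Longrightarrow> s \<ge> 0 \<Longrightarrow> S (t + s) = S t o\<^sub>L S s" "S 0 = id_blinfun"
    "((\<lambda>t. S t x) \<longlongrightarrow> x) (at_right 0)"
    using assms by (auto simp: C0_semigroup_def)
  have incr: "norm (S t x - S s x) \<le> norm (S (t - s) x - x)" if "0 \<le> s" "s \<le> t" for s t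
  proof -
    have "S t x - S s x = S s (S (t - s) x - x)"
      using S(1)[of s "t - s"] that by (simp add: blinfun.diff_right)
    also have "norm \<dots> \<le> norm (S s) * norm (S (t - s) x - x)" by (rule norm_blinfun)
    also have "\<dots> \<le> 1 * norm (S (t - s) x - x)" using contr that by (intro mult_right_mono) auto
    finally show ?thesis by simp
  qed
  fix t e :: real assume t: "t \<in> {0..}" and "e > 0"
  then obtain d where d: "d > 0" "\<And>h. h > 0 \<Longrightarrow> h < d \<Longrightarrow> dist (S h x) x < e"
    using tendstoD[OF S(3) \<open>e > 0\<close>] by (auto simp: eventually_at_right_field)
  have near: "norm (S h x - x) < e" if "0 \<le> h" "h < d" for h
    using d(2)[of h] that \<open>e > 0\<close> S(2) by (cases "h = 0") (auto simp: dist_norm id_blinfun.rep_eq)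
  show "\<exists>d>0. \<forall>s\<in>{0..}. dist s t < d \<longrightarrow> dist (S s x) (S t x) < e"
  proof (intro exI[of _ d] conjI ballI impI d(1))
    fix s assume s: "s \<in> {0..}" "dist s t < d"
    show "dist (S s x) (S t x) < e"
    proof (cases "s \<le> t")
      case True
      then have "norm (S t x - S s x) < e"
        using incr[of s t] near[of "t - s"] s by (auto simp: dist_real_def)
      then show ?thesis by (simp add: dist_norm norm_minus_commute)
    next
      case False
      then have "norm (S s x - S t x) < e"
        using incr[of t s] near[of "s - t"] s t by (auto simp: dist_real_def)
      then show ?thesis by (simp add: dist_norm)
    qed
  qed
qed

text \<open>If \<open>F\<close> is the primitive of the orbit of \<open>f\<close>, then \<open>F 1\<close> lies in the domain and the
  generator maps it to \<open>S 1 f - f\<close>; since \<open>S 1\<close> is a strict contraction, every element of the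
  space has the form \<open>f - S 1 f\<close>.\<close>

lemma strict_contraction_generator_surj:
  fixes S :: "real \<Rightarrow> 'a::{real_inner, complete_space} \<Rightarrow>\<^sub>L 'a"
  assumes "quasicontraction_semigroup (- 1) S"
  shows "\<exists>x. generator_limit S x g"
proof -
  have C0: "C0_semigroup S" and exp_bound: "\<And>t. t \<ge> 0 \<Longrightarrow> norm (S t) \<le> exp (- t)"
    using assms by (auto simp: quasicontraction_semigroup_def)
  have S: "\<And>t s. t \<ge> 0 \<Longrightarrow> s \<ge> 0 \<Longrightarrow> S (t + s) = S t o\<^sub>L S s" "S 0 = id_blinfun"
    using C0 by (auto simp: C0_semigroup_def)
  have contr: "norm (S t) \<le> 1" if "t \<ge> 0" for t
    using exp_bound[OF that] that by (meson exp_le_one_iff neg_le_0_iff_le order_trans)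
  have "\<exists>!f. S 1 f - g = f"
  proof (rule banach_fix_type[of "exp (- 1)"])
    show "\<forall>x y. dist (S 1 x - g) (S 1 y - g) \<le> exp (- 1) * dist x y"
    proof (intro allI)
      fix x y
      have "norm (S 1 (x - y)) \<le> norm (S 1) * norm (x - y)" by (rule norm_blinfun)
      also have "\<dots> \<le> exp (- 1) * norm (x - y)"
        using exp_bound[of 1] by (intro mult_right_mono) auto
      finally show "dist (S 1 x - g) (S 1 y - g) \<le> exp (- 1) * dist x y"
        by (simp add: dist_norm blinfun.diff_right)
    qed
  qed auto
  then obtain f where f: "S 1 f - f = g" by (metis diff_diff_eq2 diff_add_cancel add_diff_cancel_left' add.commute)
  \<comment> \<open>The interval reaches to 2 because \<open>F (1 + h)\<close> occurs for
    \<open>h\<close> up to 1.\<close>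
  have cont: "continuous_on {0..2} (\<lambda>t. S t f)"
    using contraction_orbit_continuous[OF C0 contr] by (rule continuous_on_subset) auto
  then obtain F where F0: "F 0 = 0" and
    F: "\<And>t. t \<in> {0..2} \<Longrightarrow> (F has_vector_derivative S t f) (at t within {0..2})"
    using primitive_exists[OF cont] by auto
  have shift: "S h (F 1) = F (1 + h) - F h" if h: "0 \<le> h" "h \<le> 1" for h
  proof -
    \<comment> \<open>Both terms have derivative \<open>S (t + h) f\<close>, so \<open>G\<close> is
      constant; its value at 0 is \<open>- F h\<close>, and its value at 1 gives the shift
      identity.\<close>
    define G where "G t = S h (F t) - F (t + h)" for t
    have "(G has_vector_derivative 0) (at t within {0..1})" if t: "t \<in> {0..1}" for t
    proof -
      have "(F has_vector_derivative S t f) (at t within {0..1})"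
        using t by (intro has_vector_derivative_within_subset[OF F]) auto
      then have "((\<lambda>t. S h (F t)) has_vector_derivative S h (S t f)) (at t within {0..1})"
        by (rule bounded_linear.has_vector_derivative[OF blinfun.bounded_linear_right])
      moreover have "((F \<circ> (\<lambda>t. t + h)) has_vector_derivative 1 *\<^sub>R S (t + h) f) (at t within {0..1})"
      proof (rule vector_diff_chain_within)
        show "((\<lambda>t. t + h) has_vector_derivative 1) (at t within {0..1})"
          by (auto intro!: derivative_eq_intros)
        show "(F has_vector_derivative S (t + h) f) (at (t + h) within (\<lambda>t. t + h) ` {0..1})"
          using t h by (intro has_vector_derivative_within_subset[OF F]) auto
      qed
      moreover have "S (t + h) f = S h (S t f)" using S(1)[of h t] t h by (simp add: add.commute)
      ultimately show ?thesis
        unfolding G_def using has_vector_derivative_diff by (fastforce simp: o_def)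
    qed
    then have "G 1 = G 0"
      using has_vector_derivative_zero_constant[of "{0..1}" G]
      by (metis atLeastAtMost_iff convex_real_interval(5) order_refl zero_le_one)
    then show ?thesis by (simp add: G_def F0 blinfun.zero_right diff_eq_eq)
  qed
  have diff_quot: "((\<lambda>h. (1 / h) *\<^sub>R (F (t + h) - F t)) \<longlongrightarrow> S t f) (at_right 0)"
    if t: "t \<in> {0, 1}" for t
  proof -
    have "(F has_vector_derivative S t f) (at t within {t..t+1})"
      using t by (intro has_vector_derivative_within_subset[OF F]) auto
    then have "((\<lambda>s. (1 / norm (s - t)) *\<^sub>R (F s - (F t + (s - t) *\<^sub>R S t f))) \<longlongrightarrow> 0) (at_right t)"
      by (simp add: has_vector_derivative_def has_derivative_within at_within_Icc_at_right)
    then have "((\<lambda>h. (1 / norm h) *\<^sub>R (F (t + h) - (F t + h *\<^sub>R S t f))) \<longlongrightarrow> 0) (at_right 0)"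
      by (subst (asm) filterlim_at_right_to_0) (simp add: add.commute)
    then have "((\<lambda>h. (1 / norm h) *\<^sub>R (F (t + h) - (F t + h *\<^sub>R S t f)) + S t f) \<longlongrightarrow> 0 + S t f) (at_right 0)"
      by (intro tendsto_add tendsto_const)
    moreover have "\<forall>\<^sub>F h in at_right 0. (1 / norm h) *\<^sub>R (F (t + h) - (F t + h *\<^sub>R S t f)) + S t f
        = (1 / h) *\<^sub>R (F (t + h) - F t)"
      using eventually_at_right_less[of "0::real"]
      by (rule eventually_mono) (simp add: scaleR_diff_right scaleR_add_right)
    ultimately show ?thesis using Lim_transform_eventually by fastforce
  qed
  \<comment> \<open>By the shift identity the quotient of \<open>F\<close> at 1 minus that at 0 is
    the generator quotient at \<open>F 1\<close>.\<close>
  have "((\<lambda>h. (1 / h) *\<^sub>R (F (1 + h) - F 1) - (1 / h) *\<^sub>R (F (0 + h) - F 0)) \<longlongrightarrow> S 1 f - S 0 f) (at_right 0)"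
    by (intro tendsto_diff diff_quot) auto
  moreover have "\<forall>\<^sub>F h in at_right 0. (1 / h) *\<^sub>R (F (1 + h) - F 1) - (1 / h) *\<^sub>R (F (0 + h) - F 0)
      = (1 / h) *\<^sub>R (S h (F 1) - F 1)"
    using eventually_at_right_real[of 0 1]
    by (rule eventually_mono) (auto simp: shift F0 algebra_simps)
  ultimately have "((\<lambda>h. (1 / h) *\<^sub>R (S h (F 1) - F 1)) \<longlongrightarrow> S 1 f - S 0 f) (at_right 0)"
    by (rule Lim_transform_eventually)
  then have "generator_limit S (F 1) g" by (simp add: generator_limit_def f S(2) id_blinfun.rep_eq)
  then show ?thesis by blast
qed

text \<open>Rescaling by \<open>\<omega> + 1\<close> brings the rate to -1, where the limit
  \<open>- f\<close> is attained at some \<open>x\<close>; uniqueness of limits identifies it with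
  the value of the shifted operator.\<close>

lemma generator_range:
  fixes S :: "real \<Rightarrow> 'a::{real_inner, complete_space} \<Rightarrow>\<^sub>L 'a"
  assumes S: "quasicontraction_semigroup \<omega> S" "is_generator D A S"
  obtains x where "x \<in> D" "(\<omega> + 1) *\<^sub>R x - A x = f"
proof -
  define V where "V t = exp (- (\<omega> + 1) * t) *\<^sub>R S t" for t
  have V: "is_generator D (\<lambda>x. A x - (\<omega> + 1) *\<^sub>R x) V"
    unfolding V_def using S(2) by (rule is_generator_rescale)
  have "quasicontraction_semigroup (\<omega> - (\<omega> + 1)) V"
    unfolding V_def using S(1) by (rule quasicontraction_semigroup_rescale)
  then obtain x where x: "generator_limit V x (- f)"
    using strict_contraction_generator_surj[of V "- f"] by auto
  then have "x \<in> D" using V by (auto simp: is_generator_iff)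
  then have "generator_limit V x (A x - (\<omega> + 1) *\<^sub>R x)" using V by (auto simp: is_generator_iff)
  with x have "A x - (\<omega> + 1) *\<^sub>R x = - f"
    unfolding generator_limit_def by (intro tendsto_unique) auto
  then have "(\<omega> + 1) *\<^sub>R x - A x = f" by (metis minus_diff_eq minus_minus)
  with \<open>x \<in> D\<close> that show ?thesis by blast
qed

section \<open>Yosida approximation\<close>

text \<open>Linearity is imposed on \<open>D\<close> alone because values of \<open>A\<close>
  elsewhere are arbitrary. Solvability for a single \<open>\<mu>\<close> suffices, as arbitrarily
  small steps are reached from it by iteration.\<close>

locale m_dissipative =
  fixes D :: "'a::{real_inner, complete_space} set" and A :: "'a \<Rightarrow> 'a"
  assumes subspace_D: "subspace D"
    and A_add: "\<And>x y. x \<in> D \<Longrightarrow> y \<in> D \<Longrightarrow> A (x + y) = A x + A y"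
    and A_scaleR: "\<And>x c. x \<in> D \<Longrightarrow> A (c *\<^sub>R x) = c *\<^sub>R A x"
    and A_dissipative: "\<And>x. x \<in> D \<Longrightarrow> x \<bullet> A x \<le> 0"
    and A_range: "\<exists>\<mu>>0. \<forall>f. \<exists>x\<in>D. \<mu> *\<^sub>R x - A x = f"
begin

lemma D_add: "x \<in> D \<Longrightarrow> y \<in> D \<Longrightarrow> x + y \<in> D"
  and D_scaleR: "x \<in> D \<Longrightarrow> c *\<^sub>R x \<in> D"
  and D_diff: "x \<in> D \<Longrightarrow> y \<in> D \<Longrightarrow> x - y \<in> D"
  using subspace_D by (auto intro: subspace_add subspace_scale subspace_diff)

lemma A_diff: "x \<in> D \<Longrightarrow> y \<in> D \<Longrightarrow> A (x - y) = A x - A y"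
  using A_add[of "x - y" y] D_diff[of x y] by (simp add: algebra_simps)

text \<open>Pairing \<open>x - \<epsilon> *\<^sub>R A x\<close> with \<open>x\<close> loses nothing
  by dissipativity. Applied to differences, this yields uniqueness and nonexpansiveness of the
  resolvent.\<close>

lemma norm_le_resolvent:
  assumes "x \<in> D" "\<epsilon> \<ge> 0"
  shows "norm x \<le> norm (x - \<epsilon> *\<^sub>R A x)"
proof (rule norm_le_if_inner_le)
  have "x \<bullet> x \<le> x \<bullet> (x - \<epsilon> *\<^sub>R A x)"
    using A_dissipative[OF assms(1)] assms(2) by (simp add: inner_diff_right mult_nonneg_nonpos)
  also have "\<dots> \<le> norm (x - \<epsilon> *\<^sub>R A x) * norm x"
    using norm_cauchy_schwarz[of x "x - \<epsilon> *\<^sub>R A x"] by (simp only: mult.commute)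
  finally show "x \<bullet> x \<le> norm (x - \<epsilon> *\<^sub>R A x) * norm x" .
qed simp

lemma resolvent_unique:
  assumes "x \<in> D" "y \<in> D" "\<epsilon> \<ge> 0" "x - \<epsilon> *\<^sub>R A x = y - \<epsilon> *\<^sub>R A y"
  shows "x = y"
proof -
  have "(x - y) - \<epsilon> *\<^sub>R A (x - y) = 0" using assms by (simp add: A_diff algebra_simps)
  then have "norm (x - y) \<le> 0" using norm_le_resolvent[OF D_diff[OF assms(1,2)] assms(3)] by simp
  then show ?thesis by simp
qed

text \<open>A null sequence starting at \<open>1 / \<mu>\<close> for a chosen solvable
  \<open>\<mu>\<close>; its ratio 2/3 is the reduction that one fixed-point argument
  achieves.\<close>

definition step_size :: "nat \<Rightarrow> real" where
  "step_size n = (2/3) ^ n / (SOME \<mu>. \<mu> > 0 \<and> (\<forall>f. \<exists>x\<in>D. \<mu> *\<^sub>R x - A x = f))"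

lemma A_range': 
  obtains \<mu> where "\<mu> > 0" "\<And>f. \<exists>x\<in>D. \<mu> *\<^sub>R x - A x = f" "\<And>n. step_size n = (2/3)^n / \<mu>"
proof -
  define \<mu> where "\<mu> = (SOME \<mu>. \<mu> > 0 \<and> (\<forall>f. \<exists>x\<in>D. \<mu> *\<^sub>R x - A x = f))"
  have "\<mu> > 0 \<and> (\<forall>f. \<exists>x\<in>D. \<mu> *\<^sub>R x - A x = f)" unfolding \<mu>_def using A_range by (rule someI_ex)
  then show ?thesis using that by (auto simp: step_size_def \<mu>_def)
qed

lemma step_size_pos: "step_size n > 0"
  by (rule A_range') simp

lemma step_size_tendsto: "step_size \<longlonglongrightarrow> 0"
proof (rule A_range')
  fix \<mu> assume "\<mu> > 0" and eq: "\<And>n. step_size n = (2/3)^n / \<mu>"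
  then have "(\<lambda>n. (2/3::real)^n / \<mu>) \<longlonglongrightarrow> 0 / \<mu>"
    by (intro tendsto_divide tendsto_const LIMSEQ_power_zero) auto
  then show ?thesis by (simp add: eq[abs_def])
qed

text \<open>Solvability for \<open>\<epsilon>\<close> passes to \<open>2 \<epsilon> / 3\<close>, because the new equation is
  \<open>x - \<epsilon> A x = (3/2) f - x/2\<close> and the resolvent is nonexpansive.\<close>

lemma resolvent_exists_step:
  assumes "\<epsilon> > 0" and solv: "\<And>f. \<exists>x\<in>D. x - \<epsilon> *\<^sub>R A x = f"
  shows "\<exists>x\<in>D. x - (2/3 * \<epsilon>) *\<^sub>R A x = f"
proof -
  obtain R where R: "\<And>f. R f \<in> D" "\<And>f. R f - \<epsilon> *\<^sub>R A (R f) = f" using solv by metis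
  have contr: "norm (R f - R g) \<le> norm (f - g)" for f g
  proof -
    have "norm (R f - R g) \<le> norm ((R f - R g) - \<epsilon> *\<^sub>R A (R f - R g))"
      using assms(1) by (intro norm_le_resolvent D_diff R) auto
    also have "(R f - R g) - \<epsilon> *\<^sub>R A (R f - R g)
        = (R f - \<epsilon> *\<^sub>R A (R f)) - (R g - \<epsilon> *\<^sub>R A (R g))"
      by (simp add: A_diff R(1) algebra_simps)
    also have "\<dots> = f - g" by (simp only: R(2))
    finally show ?thesis .
  qed
  have "\<exists>!x. R ((3/2) *\<^sub>R f - (1/2) *\<^sub>R x) = x"
  proof (rule banach_fix_type[of "1/2"])
    show "\<forall>x y. dist (R ((3/2) *\<^sub>R f - (1/2) *\<^sub>R x)) (R ((3/2) *\<^sub>R f - (1/2) *\<^sub>R y)) \<le> 1/2 * dist x y"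
    proof (intro allI)
      fix x y
      have "(3/2) *\<^sub>R f - (1/2) *\<^sub>R x - ((3/2) *\<^sub>R f - (1/2) *\<^sub>R y) = (1/2) *\<^sub>R (y - x)"
        by (simp add: algebra_simps)
      then have "norm ((3/2) *\<^sub>R f - (1/2) *\<^sub>R x - ((3/2) *\<^sub>R f - (1/2) *\<^sub>R y)) = 1/2 * dist x y"
        by (simp add: dist_norm norm_minus_commute)
      then show "dist (R ((3/2) *\<^sub>R f - (1/2) *\<^sub>R x)) (R ((3/2) *\<^sub>R f - (1/2) *\<^sub>R y)) \<le> 1/2 * dist x y"
        using contr by (metis dist_norm)
    qed
  qed auto
  then obtain x where x: "R ((3/2) *\<^sub>R f - (1/2) *\<^sub>R x) = x" by blast
  then have xD: "x \<in> D" and eq: "x - \<epsilon> *\<^sub>R A x = (3/2) *\<^sub>R f - (1/2) *\<^sub>R x" using R by metis+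
  have "(2/3) *\<^sub>R x + (1/3) *\<^sub>R x = x" by (simp flip: scaleR_add_left)
  then have "x - (2/3 * \<epsilon>) *\<^sub>R A x = (2/3) *\<^sub>R (x - \<epsilon> *\<^sub>R A x) + (1/3) *\<^sub>R x"
    by (simp add: scaleR_diff_right diff_add_eq)
  also have "\<dots> = f" unfolding eq by (simp add: scaleR_diff_right)
  finally have "x - (2/3 * \<epsilon>) *\<^sub>R A x = f" .
  with xD show ?thesis by blast
qed

lemma resolvent_exists: "\<exists>x\<in>D. x - step_size n *\<^sub>R A x = f"
proof (induction n arbitrary: f)
  case 0
  show ?case
  proof (rule A_range')
    fix \<mu> assume \<mu>: "\<mu> > 0" "\<And>f. \<exists>x\<in>D. \<mu> *\<^sub>R x - A x = f" and "\<And>n. step_size n = (2/3)^n / \<mu>"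
    then have e: "step_size 0 = 1 / \<mu>" by simp
    obtain x where x: "x \<in> D" "\<mu> *\<^sub>R x - A x = \<mu> *\<^sub>R f" using \<mu> by blast
    have "x - (1 / \<mu>) *\<^sub>R A x = (1 / \<mu>) *\<^sub>R (\<mu> *\<^sub>R x - A x)" using \<mu>(1) by (simp add: scaleR_diff_right)
    also have "\<dots> = f" using \<mu>(1) by (simp add: x(2))
    finally show ?thesis using x(1) e by auto
  qed
next
  case (Suc n)
  have "step_size (Suc n) = 2/3 * step_size n" by (simp add: step_size_def)
  then show ?case using resolvent_exists_step[OF step_size_pos Suc] by (simp only:)
qed

text \<open>The operator \<open>(I - \<epsilon> A)^-1\<close> with
  \<open>\<epsilon> = step_size n\<close>, defined on the whole space.\<close>

definition resolvent :: "nat \<Rightarrow> 'a \<Rightarrow> 'a" where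
  "resolvent n f = (SOME x. x \<in> D \<and> x - step_size n *\<^sub>R A x = f)"

lemma resolvent_D: "resolvent n f \<in> D"
  and resolvent_eq: "resolvent n f - step_size n *\<^sub>R A (resolvent n f) = f"
proof -
  have "\<exists>x. x \<in> D \<and> x - step_size n *\<^sub>R A x = f" using resolvent_exists[of n f] by blast
  from someI_ex[OF this]
  show "resolvent n f \<in> D" "resolvent n f - step_size n *\<^sub>R A (resolvent n f) = f"
    by (simp_all add: resolvent_def)
qed

lemma resolvent_eqI:
  assumes "x \<in> D" "x - step_size n *\<^sub>R A x = f"
  shows "resolvent n f = x"
  using assms step_size_pos[of n]
  by (intro resolvent_unique[OF resolvent_D, of x "step_size n"]) (auto simp: resolvent_eq)

lemma norm_resolvent_le: "norm (resolvent n f) \<le> norm f"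
  using norm_le_resolvent[OF resolvent_D, of "step_size n" n f] step_size_pos[of n]
  by (simp add: resolvent_eq)

lemma resolvent_add: "resolvent n (f + g) = resolvent n f + resolvent n g"
proof (rule resolvent_eqI)
  show "resolvent n f + resolvent n g \<in> D" by (intro D_add resolvent_D)
  have "resolvent n f + resolvent n g - step_size n *\<^sub>R A (resolvent n f + resolvent n g)
    = (resolvent n f - step_size n *\<^sub>R A (resolvent n f)) + (resolvent n g - step_size n *\<^sub>R A (resolvent n g))"
    by (simp add: A_add resolvent_D algebra_simps)
  then show "resolvent n f + resolvent n g - step_size n *\<^sub>R A (resolvent n f + resolvent n g) = f + g"
    by (simp only: resolvent_eq)
qed

lemma resolvent_scaleR: "resolvent n (c *\<^sub>R f) = c *\<^sub>R resolvent n f"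
proof (rule resolvent_eqI)
  show "c *\<^sub>R resolvent n f \<in> D" by (intro D_scaleR resolvent_D)
  have "c *\<^sub>R resolvent n f - step_size n *\<^sub>R A (c *\<^sub>R resolvent n f)
    = c *\<^sub>R (resolvent n f - step_size n *\<^sub>R A (resolvent n f))"
    by (simp add: A_scaleR resolvent_D algebra_simps)
  then show "c *\<^sub>R resolvent n f - step_size n *\<^sub>R A (c *\<^sub>R resolvent n f) = c *\<^sub>R f"
    by (simp only: resolvent_eq)
qed

lemma bounded_linear_resolvent: "bounded_linear (resolvent n)"
  by (rule bounded_linear_intro[where K = 1])
    (auto simp: resolvent_add resolvent_scaleR norm_resolvent_le)

section \<open>Yosida approximations\<close>

text \<open>This is \<open>A (I - \<epsilon> A)^-1\<close>, written without \<open>A\<close> so that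
  bounded linearity is inherited from the resolvent; \<open>yosida_eq\<close> recovers the product
  form.\<close>

definition yosida :: "nat \<Rightarrow> 'a \<Rightarrow> 'a" where
  "yosida n f = (1 / step_size n) *\<^sub>R (resolvent n f - f)"

lemma yosida_eq: "yosida n f = A (resolvent n f)"
proof -
  have "resolvent n f - f = step_size n *\<^sub>R A (resolvent n f)"
    using resolvent_eq[of n f] by (simp add: algebra_simps)
  then show ?thesis using step_size_pos[of n] by (simp add: yosida_def)
qed

lemma resolvent_yosida: "f = resolvent n f - step_size n *\<^sub>R yosida n f"
  by (simp add: yosida_eq resolvent_eq)

text \<open>On \<open>D\<close> the resolvent commutes with \<open>A\<close>, because it maps
  \<open>x - \<epsilon> *\<^sub>R A x\<close> to \<open>x\<close>. The bound by
  \<open>norm (A x)\<close>, uniform in \<open>n\<close>, follows.\<close>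

lemma yosida_on_D: "x \<in> D \<Longrightarrow> yosida n x = resolvent n (A x)"
proof -
  assume x: "x \<in> D"
  have "resolvent n (x - step_size n *\<^sub>R A x) = x" using x by (rule resolvent_eqI) simp
  then have "resolvent n x - step_size n *\<^sub>R resolvent n (A x) = x"
    using bounded_linear_resolvent[of n] by (simp add: linear_diff bounded_linear.linear resolvent_scaleR)
  then have "resolvent n x - x = step_size n *\<^sub>R resolvent n (A x)" by (simp add: algebra_simps)
  then show ?thesis using step_size_pos[of n] by (simp add: yosida_def)
qed

lemma norm_yosida_le: "x \<in> D \<Longrightarrow> norm (yosida n x) \<le> norm (A x)"
  by (simp add: yosida_on_D norm_resolvent_le)

lemma bounded_linear_yosida: "bounded_linear (yosida n)"
  unfolding yosida_def
  by (intro bounded_linear_compose[OF bounded_linear_scaleR_right] bounded_linear_sub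
      bounded_linear_resolvent bounded_linear_ident)

lemma yosida_dissipative: "yosida n f \<bullet> f \<le> 0"
proof -
  have "resolvent n f \<bullet> f \<le> norm (resolvent n f) * norm f" by (rule norm_cauchy_schwarz)
  also have "\<dots> \<le> norm f * norm f" by (intro mult_right_mono norm_resolvent_le) simp
  finally have "(resolvent n f - f) \<bullet> f \<le> 0"
    by (simp add: inner_diff_left power2_norm_eq_inner[symmetric] power2_eq_square)
  then show ?thesis using step_size_pos[of n] by (simp add: yosida_def divide_nonpos_pos)
qed

text \<open>If \<open>z\<close> is orthogonal to \<open>D\<close>, then so it is to its own
  resolvent \<open>v\<close>; the equation for \<open>v\<close> and dissipativity give
  \<open>v \<bullet> v \<le> 0\<close>, so \<open>v\<close> and \<open>z\<close> vanish.\<close>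

lemma dense_D: "closure D = UNIV"
proof (rule dense_subspace_if_orthogonal_trivial[OF subspace_D])
  fix z assume orth: "\<And>d. d \<in> D \<Longrightarrow> z \<bullet> d = 0"
  define v where "v = resolvent 0 z"
  have v: "v \<in> D" and eq: "v - step_size 0 *\<^sub>R A v = z"
    by (simp_all add: v_def resolvent_D resolvent_eq)
  have "v \<bullet> (v - step_size 0 *\<^sub>R A v) = 0" using orth[OF v] by (simp add: eq inner_commute)
  moreover have "step_size 0 * (v \<bullet> A v) \<le> 0"
    using A_dissipative[OF v] step_size_pos[of 0] by (simp add: mult_nonneg_nonpos)
  ultimately have "v \<bullet> v \<le> 0" by (simp add: inner_diff_right)
  then have "v = 0" by (metis inner_gt_zero_iff not_le)
  moreover have "A 0 = 0" using A_scaleR[OF v, of 0] by simp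
  ultimately show "z = 0" using eq by simp
qed

lemma approx_D:
  assumes "e > 0"
  obtains y where "y \<in> D" "norm (y - x) < e"
proof -
  have "x \<in> closure D" by (simp add: dense_D)
  then show ?thesis using assms that by (auto simp: closure_approachable dist_norm)
qed

text \<open>For \<open>y\<close> in \<open>D\<close> the error is
  \<open>step_size n *\<^sub>R yosida n y\<close>, of norm at most
  \<open>step_size n * norm (A y)\<close>. Density and nonexpansiveness extend the convergence to
  all \<open>x\<close>.\<close>

lemma resolvent_tendsto: "(\<lambda>n. resolvent n x) \<longlonglongrightarrow> x"
proof (rule LIMSEQ_I)
  fix r :: real assume "r > 0"
  then obtain y where y: "y \<in> D" "norm (y - x) < r / 3" using approx_D[of "r/3" x] by auto
  have "(\<lambda>n. step_size n * norm (A y)) \<longlonglongrightarrow> 0 * norm (A y)" by (intro tendsto_intros step_size_tendsto)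
  then have "\<forall>\<^sub>F n in sequentially. step_size n * norm (A y) < r / 3"
    using \<open>r > 0\<close> by (intro order_tendstoD(2)) auto
  then obtain N where N: "\<And>n. n \<ge> N \<Longrightarrow> step_size n * norm (A y) < r / 3"
    by (auto simp: eventually_sequentially)
  have "norm (resolvent n x - x) < r" if "n \<ge> N" for n
  proof -
    have "resolvent n x - x = resolvent n (x - y) + step_size n *\<^sub>R yosida n y + (y - x)"
      using resolvent_yosida[of y n] resolvent_add[of n "x - y" y] by (simp add: algebra_simps)
    then have "norm (resolvent n x - x)
        \<le> norm (resolvent n (x - y)) + norm (step_size n *\<^sub>R yosida n y) + norm (y - x)"
      by (metis norm_triangle_ineq norm_triangle_mono order_refl)
    moreover have "norm (resolvent n (x - y)) \<le> norm (y - x)"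
      using norm_resolvent_le[of n "x - y"] by (simp add: norm_minus_commute)
    moreover have "norm (step_size n *\<^sub>R yosida n y) \<le> step_size n * norm (A y)"
      using norm_yosida_le[OF y(1), of n] step_size_pos[of n] by (simp add: mult_left_mono)
    ultimately show ?thesis using y(2) N[OF that] by linarith
  qed
  then show "\<exists>N. \<forall>n\<ge>N. norm (resolvent n x - x) < r" by blast
qed

section \<open>Flows of the Yosida approximations\<close>

text \<open>The exponential of \<open>t\<close> times \<open>yosida n\<close>, applied to
  \<open>x\<close>, picked as a solution of the differential equation; for \<open>t \<ge> 0\<close>
  the choice is unique by \<open>flow_unique\<close>.\<close>

definition flow :: "nat \<Rightarrow> real \<Rightarrow> 'a \<Rightarrow> 'a" where
  "flow n t x = (SOME u. u 0 = x \<and> (\<forall>t. (u has_vector_derivative yosida n (u t)) (at t))) t"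

lemma flow_0: "flow n 0 x = x"
  and flow_deriv: "((\<lambda>t. flow n t x) has_vector_derivative yosida n (flow n t x)) (at t)"
proof -
  have "\<exists>u. u 0 = x \<and> (\<forall>t. (u has_vector_derivative yosida n (u t)) (at t))"
    by (rule linear_ode_solution_exists[OF bounded_linear_yosida, of x n]) blast
  from someI_ex[OF this]
  show "flow n 0 x = x" "((\<lambda>t. flow n t x) has_vector_derivative yosida n (flow n t x)) (at t)"
    by (simp_all add: flow_def)
qed

lemma norm_flow_le: "t \<ge> 0 \<Longrightarrow> norm (flow n t x) \<le> norm x"
  using dissipative_ode_norm_le[where u = "\<lambda>t. flow n t x", OF yosida_dissipative[of n] flow_deriv] by (simp add: flow_0)

text \<open>The difference of two solutions is again a solution, and its norm does not increase from
  0. Linearity, the semigroup law and commutation with \<open>yosida n\<close> all come from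
  this.\<close>

lemma flow_unique:
  assumes u: "\<And>t. (u has_vector_derivative yosida n (u t)) (at t)" and "t \<ge> 0"
  shows "u t = flow n t (u 0)"
proof -
  interpret bounded_linear "yosida n" by (rule bounded_linear_yosida)
  have "norm (u t - flow n t (u 0)) \<le> norm (u 0 - flow n 0 (u 0))"
  proof (rule dissipative_ode_norm_le[OF yosida_dissipative _ \<open>t \<ge> 0\<close>])
    show "((\<lambda>t. u t - flow n t (u 0)) has_vector_derivative yosida n (u t - flow n t (u 0))) (at t)" for t
      unfolding diff by (intro has_vector_derivative_diff u flow_deriv)
  qed
  then show ?thesis by (simp add: flow_0)
qed

lemma flow_add: "t \<ge> 0 \<Longrightarrow> flow n t (x + y) = flow n t x + flow n t y"
  using flow_unique[of "\<lambda>t. flow n t x + flow n t y" n t]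
    has_vector_derivative_add[OF flow_deriv[of n x] flow_deriv[of n y]]
  by (simp add: flow_0 linear_add[OF bounded_linear.linear[OF bounded_linear_yosida]])

lemma flow_scaleR: "t \<ge> 0 \<Longrightarrow> flow n t (c *\<^sub>R x) = c *\<^sub>R flow n t x"
  using flow_unique[of "\<lambda>t. c *\<^sub>R flow n t x" n t]
    bounded_linear.has_vector_derivative[OF bounded_linear_scaleR_right flow_deriv[of n x], of c]
  by (simp add: flow_0 linear_scale[OF bounded_linear.linear[OF bounded_linear_yosida]])

lemma flow_diff: "t \<ge> 0 \<Longrightarrow> flow n t (x - y) = flow n t x - flow n t y"
  using flow_add[of t n "x - y" y] by (simp add: algebra_simps)

lemma flow_semigroup:
  assumes "t \<ge> 0"
  shows "flow n (t + s) x = flow n t (flow n s x)"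
proof -
  have "((\<lambda>t. flow n (t + s) x) has_vector_derivative yosida n (flow n (t + s) x)) (at t)" for t
  proof -
    have "((\<lambda>t. t + s) has_vector_derivative 1) (at t)" by (auto intro!: derivative_eq_intros)
    from vector_diff_chain_at[OF this flow_deriv[of n x]] show ?thesis by (simp add: o_def)
  qed
  from flow_unique[OF this assms] show ?thesis by simp
qed

text \<open>The image of a solution under \<open>yosida n\<close> solves the same equation. This
  keeps the velocity along an orbit starting in \<open>D\<close> below \<open>norm (A x)\<close>,
  uniformly in \<open>n\<close> and \<open>t\<close>.\<close>

lemma yosida_flow: "t \<ge> 0 \<Longrightarrow> yosida n (flow n t x) = flow n t (yosida n x)"
  using flow_unique[of "\<lambda>t. yosida n (flow n t x)" n t]
    bounded_linear.has_vector_derivative[OF bounded_linear_yosida flow_deriv[of n x]]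
  by (simp add: flow_0)

lemma norm_yosida_flow_le: "t \<ge> 0 \<Longrightarrow> x \<in> D \<Longrightarrow> norm (yosida n (flow n t x)) \<le> norm (A x)"
  using norm_flow_le[of t n "yosida n x"] norm_yosida_le[of x n] by (simp add: yosida_flow)

text \<open>Since \<open>f = resolvent n f - step_size n *\<^sub>R yosida n f\<close> and \<open>A\<close> is dissipative, two Yosida
  approximations are jointly dissipative up to an error of the order of the step sizes.\<close>

lemma yosida_diff_inner:
  assumes "norm (yosida n u) \<le> K" "norm (yosida m v) \<le> K"
  shows "(yosida n u - yosida m v) \<bullet> (u - v) \<le> 2 * K\<^sup>2 * (step_size n + step_size m)"
proof -
  define p q where "p = yosida n u" and "q = yosida m v"
  define e d where "e = step_size n" and "d = step_size m"
  have pos: "e > 0" "d > 0" by (simp_all add: e_def d_def step_size_pos)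
  have "(p - q) \<bullet> (resolvent n u - resolvent m v) \<le> 0"
    using A_dissipative[OF D_diff[OF resolvent_D[of n u] resolvent_D[of m v]]]
    by (simp add: p_def q_def yosida_eq A_diff resolvent_D inner_commute)
  moreover have "u - v = (resolvent n u - resolvent m v) - (e *\<^sub>R p - d *\<^sub>R q)"
  proof -
    have "u = resolvent n u - e *\<^sub>R p" "v = resolvent m v - d *\<^sub>R q"
      unfolding p_def q_def e_def d_def by (rule resolvent_yosida)+
    then have "u - v = (resolvent n u - e *\<^sub>R p) - (resolvent m v - d *\<^sub>R q)" by simp
    then show ?thesis by (simp add: algebra_simps)
  qed
  ultimately have "(p - q) \<bullet> (u - v) \<le> - ((p - q) \<bullet> (e *\<^sub>R p - d *\<^sub>R q))"
    by (simp add: inner_diff_right)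
  also have "\<dots> \<le> norm (p - q) * norm (e *\<^sub>R p - d *\<^sub>R q)"
    using Cauchy_Schwarz_ineq2[of "p - q" "e *\<^sub>R p - d *\<^sub>R q"] by linarith
  also have "\<dots> \<le> (K + K) * (e * K + d * K)"
  proof (rule mult_mono)
    show "norm (p - q) \<le> K + K"
      using assms norm_triangle_ineq4[of p q] by (simp add: p_def q_def)
    have "norm (e *\<^sub>R p - d *\<^sub>R q) \<le> e * norm p + d * norm q"
      using norm_triangle_ineq4[of "e *\<^sub>R p" "d *\<^sub>R q"] pos by simp
    also have "\<dots> \<le> e * K + d * K"
      using assms pos by (intro add_mono mult_left_mono) (auto simp: p_def q_def)
    finally show "norm (e *\<^sub>R p - d *\<^sub>R q) \<le> e * K + d * K" .
    show "0 \<le> K + K" using order_trans[OF norm_ge_zero assms(1)] by simp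
  qed simp
  also have "\<dots> = 2 * K\<^sup>2 * (e + d)" by (simp add: power2_eq_square algebra_simps)
  finally show ?thesis by (simp add: p_def q_def e_def d_def)
qed

lemma flow_cauchy_estimate:
  assumes "x \<in> D" "t \<ge> 0"
  shows "(norm (flow n t x - flow m t x))\<^sup>2 \<le> 4 * (norm (A x))\<^sup>2 * (step_size n + step_size m) * t"
proof -
  \<comment> \<open>Twice the bound of \<open>yosida_diff_inner\<close> with
    \<open>K = norm (A x)\<close>, since \<open>w \<bullet> w\<close> has derivative twice the inner
    product of \<open>w\<close> with its velocity. Subtracting \<open>C * t\<close> then leaves a
    nonincreasing function.\<close>
  define C where "C = 4 * (norm (A x))\<^sup>2 * (step_size n + step_size m)"
  define w where "w t = flow n t x - flow m t x" for t
  have w: "(w has_vector_derivative yosida n (flow n s x) - yosida m (flow m s x)) (at s)" for s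
    unfolding w_def by (intro has_vector_derivative_diff flow_deriv)
  have "w t \<bullet> w t - C * t \<le> w 0 \<bullet> w 0 - C * 0"
  proof (rule DERIV_nonpos_imp_nonincreasing[OF \<open>t \<ge> 0\<close>])
    fix s :: real assume s: "0 \<le> s"
    define d where "d = (yosida n (flow n s x) - yosida m (flow m s x)) \<bullet> w s"
    have "((\<lambda>s. w s \<bullet> w s) has_real_derivative 2 * d) (at s)"
      using bounded_bilinear.has_vector_derivative[OF bounded_bilinear_inner w w, of s]
      by (simp add: has_real_derivative_iff_has_vector_derivative inner_commute d_def)
    then have "((\<lambda>s. w s \<bullet> w s - C * s) has_real_derivative 2 * d - C) (at s)"
      by (auto intro!: derivative_eq_intros)
    moreover have "2 * d - C \<le> 0"
      using yosida_diff_inner[OF norm_yosida_flow_le[OF s assms(1)] norm_yosida_flow_le[OF s assms(1)], of n m]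
      by (simp add: d_def w_def C_def algebra_simps)
    ultimately show "\<exists>y. ((\<lambda>s. w s \<bullet> w s - C * s) has_real_derivative y) (at s) \<and> y \<le> 0" by blast
  qed
  then show ?thesis by (simp add: w_def flow_0 C_def power2_norm_eq_inner)
qed

text \<open>Orbits from \<open>D\<close> are Cauchy by the estimate above; contractivity, uniform in
  \<open>n\<close>, carries this to limits of points of \<open>D\<close>.\<close>

lemma flow_convergent:
  assumes "t \<ge> 0"
  shows "convergent (\<lambda>n. flow n t x)"
proof (rule Cauchy_convergent, rule metric_CauchyI)
  fix e :: real assume "e > 0"
  then obtain y where y: "y \<in> D" "norm (y - x) < e / 3" using approx_D[of "e/3" x] by auto
  define C where "C = 4 * (norm (A y))\<^sup>2"
  have "(\<lambda>n. C * t * step_size n) \<longlonglongrightarrow> C * t * 0" by (intro tendsto_intros step_size_tendsto)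
  then have "\<forall>\<^sub>F n in sequentially. C * t * step_size n < (e/3)\<^sup>2 / 2"
    using \<open>e > 0\<close> by (intro order_tendstoD(2)) auto
  then obtain N where N: "\<And>n. n \<ge> N \<Longrightarrow> C * t * step_size n < (e/3)\<^sup>2 / 2"
    by (auto simp: eventually_sequentially)
  have close: "norm (flow n t x - flow n t y) < e / 3" for n
    using norm_flow_le[OF assms, of n "x - y"] y(2) by (simp add: flow_diff assms norm_minus_commute)
  have "dist (flow n t x) (flow m t x) < e" if "n \<ge> N" "m \<ge> N" for n m
  proof -
    have "(norm (flow n t y - flow m t y))\<^sup>2 \<le> C * t * step_size n + C * t * step_size m"
      using flow_cauchy_estimate[OF y(1) assms, of n m] by (simp add: C_def algebra_simps)
    also have "\<dots> < (e/3)\<^sup>2" using N[OF that(1)] N[OF that(2)] by linarith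
    finally have "norm (flow n t y - flow m t y) < e / 3"
      using \<open>e > 0\<close> power_less_imp_less_base[of _ 2 "e/3"] by simp
    moreover have "norm (flow n t x - flow m t x) \<le> norm (flow n t x - flow n t y)
        + norm (flow n t y - flow m t y) + norm (flow m t y - flow m t x)"
      using norm_triangle_ineq[of "flow n t x - flow n t y" "flow n t y - flow m t y"]
        norm_triangle_ineq[of "flow n t x - flow m t y" "flow m t y - flow m t x"] by simp
    ultimately show ?thesis
      using close[of n] close[of m] by (simp add: dist_norm norm_minus_commute)
  qed
  then show "\<exists>M. \<forall>m\<ge>M. \<forall>n\<ge>M. dist (flow m t x) (flow n t x) < e" by blast
qed

section \<open>The limit semigroup and its generator\<close>

definition limit_flow :: "real \<Rightarrow> 'a \<Rightarrow> 'a" where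
  "limit_flow t x = lim (\<lambda>n. flow n t x)"

lemma flow_tendsto: "t \<ge> 0 \<Longrightarrow> (\<lambda>n. flow n t x) \<longlonglongrightarrow> limit_flow t x"
  unfolding limit_flow_def using flow_convergent by (simp add: convergent_LIMSEQ_iff)

lemma limit_flow_0: "limit_flow 0 x = x"
  by (simp add: limit_flow_def flow_0)

lemma norm_limit_flow_le: "t \<ge> 0 \<Longrightarrow> norm (limit_flow t x) \<le> norm x"
  by (rule LIMSEQ_le_const2[OF tendsto_norm[OF flow_tendsto]]) (auto simp: norm_flow_le)

lemma limit_flow_add: "t \<ge> 0 \<Longrightarrow> limit_flow t (x + y) = limit_flow t x + limit_flow t y"
  by (rule LIMSEQ_unique[OF flow_tendsto]) (simp_all add: flow_add tendsto_add flow_tendsto)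

lemma limit_flow_scaleR: "t \<ge> 0 \<Longrightarrow> limit_flow t (c *\<^sub>R x) = c *\<^sub>R limit_flow t x"
  by (rule LIMSEQ_unique[OF flow_tendsto]) (simp_all add: flow_scaleR tendsto_scaleR flow_tendsto)

lemma limit_flow_semigroup:
  assumes "t \<ge> 0" "s \<ge> 0"
  shows "limit_flow (t + s) x = limit_flow t (limit_flow s x)"
proof (rule LIMSEQ_unique)
  show "(\<lambda>n. flow n (t + s) x) \<longlonglongrightarrow> limit_flow (t + s) x" using assms by (intro flow_tendsto) simp
  \<comment> \<open>The operator and its argument vary together with \<open>n\<close>; contractivity
    of \<open>flow n t\<close> makes the error from replacing the argument by its limit
    vanish.\<close>
  have "(\<lambda>n. flow n s x - limit_flow s x) \<longlonglongrightarrow> 0"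
    using flow_tendsto[OF assms(2), of x] by (simp add: LIM_zero)
  then have "(\<lambda>n. flow n t (flow n s x - limit_flow s x)) \<longlonglongrightarrow> 0"
    by (rule Lim_null_comparison[rotated, OF tendsto_norm_zero])
      (simp add: norm_flow_le assms)
  then have "(\<lambda>n. flow n t (flow n s x - limit_flow s x) + flow n t (limit_flow s x))
      \<longlonglongrightarrow> 0 + limit_flow t (limit_flow s x)"
    by (intro tendsto_add flow_tendsto assms)
  then show "(\<lambda>n. flow n (t + s) x) \<longlonglongrightarrow> limit_flow t (limit_flow s x)"
    by (simp add: flow_diff flow_semigroup assms)
qed

text \<open>Used with \<open>c = 0\<close> for Lipschitz bounds on orbits and with
  \<open>c = A x\<close> for the difference quotient.\<close>

lemma flow_linearization:
  assumes "t \<ge> 0" and bound: "\<And>s. 0 \<le> s \<Longrightarrow> s \<le> t \<Longrightarrow> norm (yosida n (flow n s x) - c) \<le> K"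
  shows "norm (flow n t x - x - t *\<^sub>R c) \<le> K * t"
proof -
  have "norm (flow n t x - flow n 0 x - (t - 0) *\<^sub>R c) \<le> K * \<bar>t - 0\<bar>"
  proof (rule weak_derivative_mean_value[where S = UNIV and g = "\<lambda>s. yosida n (flow n s x)"])
    show "((\<lambda>r. flow n r x \<bullet> y) has_real_derivative yosida n (flow n r x) \<bullet> y) (at r)" for r y
      using bounded_linear.has_vector_derivative[OF bounded_linear_inner_left flow_deriv[of n x r], of y]
      by (simp add: has_real_derivative_iff_has_vector_derivative)
    show "norm (yosida n (flow n r x) - c) \<le> K" if "r \<in> closed_segment 0 t" for r
      using that assms(1) by (intro bound) (auto simp: closed_segment_eq_real_ivl)
  qed simp
  then show ?thesis using assms(1) by (simp add: flow_0)
qed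

lemma norm_flow_increment_le:
  assumes "x \<in> D" "t \<ge> 0"
  shows "norm (flow n t x - x) \<le> norm (A x) * t"
  using flow_linearization[OF assms(2), of n x 0 "norm (A x)"] norm_yosida_flow_le[OF _ assms(1)] by simp

lemma norm_limit_flow_increment_le:
  assumes "x \<in> D" "t \<ge> 0"
  shows "norm (limit_flow t x - x) \<le> norm (A x) * t"
  by (rule LIMSEQ_le_const2[OF tendsto_norm[OF tendsto_diff[OF flow_tendsto[OF assms(2)] tendsto_const]]])
    (auto simp: norm_flow_increment_le assms)

lemma limit_flow_diff: "t \<ge> 0 \<Longrightarrow> limit_flow t (x - y) = limit_flow t x - limit_flow t y"
  using limit_flow_add[of t "x - y" y] by (simp add: algebra_simps)

lemma limit_flow_at_0: "((\<lambda>t. limit_flow t x) \<longlongrightarrow> x) (at_right 0)"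
proof (rule tendstoI)
  fix e :: real assume "e > 0"
  then obtain y where y: "y \<in> D" "norm (y - x) < e / 3" using approx_D[of "e/3" x] by auto
  have "((\<lambda>t. norm (A y) * t) \<longlongrightarrow> norm (A y) * 0) (at_right 0)" by (intro tendsto_intros)
  then have "\<forall>\<^sub>F t in at_right 0. norm (A y) * t < e / 3"
    using \<open>e > 0\<close> by (intro order_tendstoD(2)) auto
  then show "\<forall>\<^sub>F t in at_right 0. dist (limit_flow t x) x < e"
    using eventually_at_right_less[of "0::real"]
  proof eventually_elim
    fix t :: real assume t: "norm (A y) * t < e / 3" "0 < t"
    have "limit_flow t x - x = limit_flow t (x - y) + (limit_flow t y - y) + (y - x)"
      using t by (simp add: limit_flow_diff)
    then have "norm (limit_flow t x - x)
        \<le> norm (limit_flow t (x - y)) + norm (limit_flow t y - y) + norm (y - x)"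
      by (metis norm_triangle_ineq norm_triangle_mono order_refl)
    moreover have "norm (limit_flow t (x - y)) \<le> norm (y - x)"
      using norm_limit_flow_le[of t "x - y"] t by (simp add: norm_minus_commute)
    moreover have "norm (limit_flow t y - y) \<le> norm (A y) * t"
      using norm_limit_flow_increment_le[OF y(1)] t by simp
    ultimately show "dist (limit_flow t x) x < e" using y(2) t by (simp add: dist_norm)
  qed
qed

text \<open>The velocity \<open>flow n s (yosida n x)\<close> must be compared with
  \<open>A x\<close>, which may lie outside \<open>D\<close>. Replacing \<open>A x\<close> by some
  \<open>y\<close> in \<open>D\<close>, whose orbit is Lipschitz, costs
  \<open>norm (y - A x)\<close> twice; the remaining resolvent error vanishes as \<open>n\<close>
  grows.\<close>

lemma limit_flow_linearization:
  assumes "x \<in> D" "y \<in> D" "t \<ge> 0"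
  shows "norm (limit_flow t x - x - t *\<^sub>R A x) \<le> (2 * norm (y - A x) + norm (A y) * t) * t"
proof -
  have bound: "norm (flow n t x - x - t *\<^sub>R A x)
      \<le> (norm (resolvent n (A x) - A x) + 2 * norm (y - A x) + norm (A y) * t) * t" for n
  proof (rule flow_linearization[OF assms(3)])
    fix s assume s: "0 \<le> s" "s \<le> t"
    have "yosida n (flow n s x) - A x
        = flow n s (yosida n x - A x) + (flow n s (A x - y) + (flow n s y - y) + (y - A x))"
      using s by (simp add: yosida_flow flow_diff)
    then have "norm (yosida n (flow n s x) - A x)
        \<le> norm (flow n s (yosida n x - A x))
          + (norm (flow n s (A x - y)) + norm (flow n s y - y) + norm (y - A x))"
      by (metis norm_triangle_ineq norm_triangle_mono order_refl)
    moreover have "norm (flow n s (yosida n x - A x)) \<le> norm (resolvent n (A x) - A x)"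
      using norm_flow_le[OF s(1)] by (simp add: yosida_on_D assms(1))
    moreover have "norm (flow n s (A x - y)) \<le> norm (y - A x)"
      using norm_flow_le[OF s(1), of n "A x - y"] by (simp add: norm_minus_commute)
    moreover have "norm (flow n s y - y) \<le> norm (A y) * t"
      using norm_flow_increment_le[OF assms(2) s(1)] mult_left_mono[OF s(2) norm_ge_zero[of "A y"]]
      by (rule order_trans)
    ultimately show "norm (yosida n (flow n s x) - A x)
        \<le> norm (resolvent n (A x) - A x) + 2 * norm (y - A x) + norm (A y) * t" by linarith
  qed
  have "(\<lambda>n. (norm (resolvent n (A x) - A x) + 2 * norm (y - A x) + norm (A y) * t) * t)
      \<longlonglongrightarrow> (norm (A x - A x) + 2 * norm (y - A x) + norm (A y) * t) * t"
    by (intro tendsto_intros resolvent_tendsto)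
  moreover have "(\<lambda>n. norm (flow n t x - x - t *\<^sub>R A x)) \<longlonglongrightarrow> norm (limit_flow t x - x - t *\<^sub>R A x)"
    by (intro tendsto_intros flow_tendsto assms)
  ultimately show ?thesis using bound LIMSEQ_le by fastforce
qed

lemma limit_flow_generator:
  assumes "x \<in> D"
  shows "((\<lambda>t. (1 / t) *\<^sub>R (limit_flow t x - x)) \<longlongrightarrow> A x) (at_right 0)"
proof (rule tendstoI)
  fix e :: real assume "e > 0"
  \<comment> \<open>The quarter compensates the factor 2 in front of \<open>norm (y - A x)\<close>;
    the other half of \<open>e\<close> is left for small \<open>t\<close>.\<close>
  then obtain y where y: "y \<in> D" "norm (y - A x) < e / 4" using approx_D[of "e/4" "A x"] by auto
  have "((\<lambda>t. norm (A y) * t) \<longlongrightarrow> norm (A y) * 0) (at_right 0)" by (intro tendsto_intros)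
  then have "\<forall>\<^sub>F t in at_right 0. norm (A y) * t < e / 2"
    using \<open>e > 0\<close> by (intro order_tendstoD(2)) auto
  then show "\<forall>\<^sub>F t in at_right 0. dist ((1 / t) *\<^sub>R (limit_flow t x - x)) (A x) < e"
    using eventually_at_right_less[of "0::real"]
  proof eventually_elim
    fix t :: real assume t: "norm (A y) * t < e / 2" "0 < t"
    have "(1 / t) *\<^sub>R (limit_flow t x - x) - A x = (1 / t) *\<^sub>R (limit_flow t x - x - t *\<^sub>R A x)"
      using t by (simp add: scaleR_diff_right)
    then have "norm ((1 / t) *\<^sub>R (limit_flow t x - x) - A x) = norm (limit_flow t x - x - t *\<^sub>R A x) / t"
      using t by simp
    also have "\<dots> \<le> 2 * norm (y - A x) + norm (A y) * t"
      using limit_flow_linearization[OF assms y(1), of t] t by (simp add: pos_divide_le_eq)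
    also have "\<dots> < e" using y t by linarith
    finally show "dist ((1 / t) *\<^sub>R (limit_flow t x - x)) (A x) < e" by (simp add: dist_norm)
  qed
qed

theorem generates_contraction_semigroup:
  "\<exists>S. quasicontraction_semigroup 0 S \<and> is_generator D A S"
proof -
  \<comment> \<open>For negative \<open>t\<close> the map \<open>limit_flow t\<close> need not be
    bounded linear, so facts about \<open>S t\<close> are drawn only for
    \<open>t \<ge> 0\<close>.\<close>
  define S where "S t = Blinfun (limit_flow t)" for t
  have S: "S t x = limit_flow t x" if "t \<ge> 0" for t x
  proof -
    have "bounded_linear (limit_flow t)"
      using that by (intro bounded_linear_intro[where K = 1])
        (auto simp: limit_flow_add limit_flow_scaleR norm_limit_flow_le)
    then show ?thesis by (simp add: S_def bounded_linear_Blinfun_apply)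
  qed
  have contr: "norm (S t) \<le> 1" if "t \<ge> 0" for t
    using that by (intro norm_blinfun_bound) (auto simp: S norm_limit_flow_le)
  have ev: "\<forall>\<^sub>F t in at_right 0. limit_flow t x = S t x" for x
    using eventually_at_right_less[of "0::real"] by (rule eventually_mono) (simp add: S)
  have "quasicontraction_semigroup 0 S"
    unfolding quasicontraction_semigroup_def C0_semigroup_def
  proof (intro conjI allI impI)
    show "S 0 = id_blinfun" by (rule blinfun_eqI) (simp add: S limit_flow_0)
    show "S (t + s) = S t o\<^sub>L S s" if "0 \<le> t" "0 \<le> s" for t s
      using that by (intro blinfun_eqI) (simp add: S limit_flow_semigroup)
    show "((\<lambda>t. S t x) \<longlongrightarrow> x) (at_right 0)" for x
      using limit_flow_at_0 ev by (rule Lim_transform_eventually)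
    show "norm (S t) \<le> exp (0 * t)" if "0 \<le> t" for t using contr[OF that] by simp
  qed
  moreover have gen: "generator_limit S x (A x)" if "x \<in> D" for x
    unfolding generator_limit_def using limit_flow_generator[OF that]
    by (rule Lim_transform_eventually) (use ev[of x] in \<open>auto elim: eventually_mono\<close>)
  \<comment> \<open>Maximality: \<open>x\<close> is compared with the \<open>z\<close> in
    \<open>D\<close> that satisfies \<open>z - e *\<^sub>R A z = x - e *\<^sub>R y\<close>.
    Dissipativity of the generator at \<open>x - z\<close>, a positive multiple of
    \<open>y - A z\<close>, forces \<open>x = z\<close>.\<close>
  moreover have "x \<in> D" if lim: "generator_limit S x y" for x y
  proof -
    define e where "e = step_size 0"
    define z where "z = resolvent 0 (x - e *\<^sub>R y)"
    have zD: "z \<in> D" by (simp add: z_def resolvent_D)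
    have "z - e *\<^sub>R A z = x - e *\<^sub>R y" by (simp add: z_def e_def resolvent_eq)
    then have xz: "x - z = e *\<^sub>R (y - A z)" by (simp add: algebra_simps)
    have "((\<lambda>t. (1 / t) *\<^sub>R (S t x - x) - (1 / t) *\<^sub>R (S t z - z)) \<longlongrightarrow> y - A z) (at_right 0)"
      using lim gen[OF zD] unfolding generator_limit_def by (rule tendsto_diff)
    then have "generator_limit S (x - z) (y - A z)"
      unfolding generator_limit_def by (simp add: blinfun.diff_right algebra_simps)
    then have "(x - z) \<bullet> (y - A z) \<le> 0" using contraction_generator_limit_dissipative contr by blast
    then have "(y - A z) \<bullet> (y - A z) \<le> 0"
      using step_size_pos[of 0] by (simp add: xz e_def mult_le_0_iff)
    then have "y - A z = 0" by (metis inner_gt_zero_iff not_le)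
    then show ?thesis using xz zD by simp
  qed
  ultimately show ?thesis unfolding is_generator_iff by blast
qed

end

section \<open>The equivalence and its form for the factored operator\<close>

text \<open>Lumer--Phillips on a Hilbert space, where density of the domain is automatic.\<close>

theorem lumer_phillips:
  fixes D :: "'a::{real_inner, complete_space} set"
  assumes "subspace D"
    and A_add: "\<And>x y. x \<in> D \<Longrightarrow> y \<in> D \<Longrightarrow> A (x + y) = A x + A y"
    and A_scaleR: "\<And>x c. x \<in> D \<Longrightarrow> A (c *\<^sub>R x) = c *\<^sub>R A x"
  shows "(\<exists>S. quasicontraction_semigroup \<omega> S \<and> is_generator D A S) \<longleftrightarrow>
    (\<forall>x\<in>D. x \<bullet> A x \<le> \<omega> * (x \<bullet> x)) \<and> (\<exists>\<mu>>\<omega>. \<forall>f. \<exists>x\<in>D. \<mu> *\<^sub>R x - A x = f)"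
proof
  assume "\<exists>S. quasicontraction_semigroup \<omega> S \<and> is_generator D A S"
  then obtain S where S: "quasicontraction_semigroup \<omega> S" "is_generator D A S" by blast
  have "\<exists>x\<in>D. (\<omega> + 1) *\<^sub>R x - A x = f" for f by (rule generator_range[OF S]) blast
  then have "\<exists>\<mu>>\<omega>. \<forall>f. \<exists>x\<in>D. \<mu> *\<^sub>R x - A x = f" by (intro exI[of _ "\<omega> + 1"]) auto
  then show "(\<forall>x\<in>D. x \<bullet> A x \<le> \<omega> * (x \<bullet> x)) \<and> (\<exists>\<mu>>\<omega>. \<forall>f. \<exists>x\<in>D. \<mu> *\<^sub>R x - A x = f)"
    using generator_dissipative[OF S] by blast
next
  assume "(\<forall>x\<in>D. x \<bullet> A x \<le> \<omega> * (x \<bullet> x)) \<and> (\<exists>\<mu>>\<omega>. \<forall>f. \<exists>x\<in>D. \<mu> *\<^sub>R x - A x = f)"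
  then obtain \<mu> where diss: "\<And>x. x \<in> D \<Longrightarrow> x \<bullet> A x \<le> \<omega> * (x \<bullet> x)"
    and \<mu>: "\<mu> > \<omega>" "\<And>f. \<exists>x\<in>D. \<mu> *\<^sub>R x - A x = f" by blast
  \<comment> \<open>Shifting by \<open>\<omega>\<close> reduces to contractions; the solvable
    parameter \<open>\<mu>\<close> becomes \<open>\<mu> - \<omega> > 0\<close>.\<close>
  interpret m_dissipative D "\<lambda>x. A x - \<omega> *\<^sub>R x"
  proof
    show "subspace D" by fact
    show "A (x + y) - \<omega> *\<^sub>R (x + y) = (A x - \<omega> *\<^sub>R x) + (A y - \<omega> *\<^sub>R y)" if "x \<in> D" "y \<in> D" for x y
      using that by (simp add: A_add algebra_simps)
    show "A (c *\<^sub>R x) - \<omega> *\<^sub>R (c *\<^sub>R x) = c *\<^sub>R (A x - \<omega> *\<^sub>R x)" if "x \<in> D" for x c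
      using that by (simp add: A_scaleR algebra_simps)
    show "x \<bullet> (A x - \<omega> *\<^sub>R x) \<le> 0" if "x \<in> D" for x
      using diss[OF that] by (simp add: inner_diff_right)
    have eq: "(\<mu> - \<omega>) *\<^sub>R x - (A x - \<omega> *\<^sub>R x) = \<mu> *\<^sub>R x - A x" for x by (simp add: algebra_simps)
    show "\<exists>\<mu>>0. \<forall>f. \<exists>x\<in>D. \<mu> *\<^sub>R x - (A x - \<omega> *\<^sub>R x) = f"
    proof (intro exI[of _ "\<mu> - \<omega>"] conjI)
      show "\<mu> - \<omega> > 0" using \<mu>(1) by simp
      show "\<forall>f. \<exists>x\<in>D. (\<mu> - \<omega>) *\<^sub>R x - (A x - \<omega> *\<^sub>R x) = f" unfolding eq using \<mu>(2) by blast
    qed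
  qed
  obtain S where S: "quasicontraction_semigroup 0 S" "is_generator D (\<lambda>x. A x - \<omega> *\<^sub>R x) S"
    using generates_contraction_semigroup by blast
  have "quasicontraction_semigroup \<omega> (\<lambda>t. exp (- (- \<omega>) * t) *\<^sub>R S t)"
    using quasicontraction_semigroup_rescale[OF S(1), of "- \<omega>"] by simp
  moreover have "is_generator D A (\<lambda>t. exp (- (- \<omega>) * t) *\<^sub>R S t)"
    using is_generator_rescale[OF S(2), of "- \<omega>"] by simp
  ultimately show "\<exists>S. quasicontraction_semigroup \<omega> S \<and> is_generator D A S" by blast
qed

theorem theorem10:
  fixes D :: "'h::{real_inner, complete_space} set"
    and \<T> \<A> :: "'h \<Rightarrow>\<^sub>L 'h"
    and A :: "'h \<Rightarrow> 'h"
    and \<omega> :: real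
  assumes "subspace D"
    and "bij_betw \<T> UNIV D"
    and "A = \<A> \<circ> inv_into UNIV \<T>"
  shows "(\<exists>S. quasicontraction_semigroup \<omega> S \<and> is_generator D A S) \<longleftrightarrow>
    (\<forall>v. \<T> v \<bullet> \<A> v \<le> \<omega> * (\<T> v \<bullet> \<T> v)) \<and>
    (\<exists>\<epsilon>>0. \<exists>\<mu>>\<omega>. \<forall>v. norm (\<mu> *\<^sub>R adjoint \<T> v - adjoint \<A> v) \<ge> \<epsilon> * norm v)"
proof -
  have D: "D = range \<T>" and inj: "inj \<T>" using assms(2) by (auto simp: bij_betw_def)
  have A: "A (\<T> v) = \<A> v" for v by (simp add: assms(3) inj)
  have A_add: "A (x + y) = A x + A y" if xy: "x \<in> D" "y \<in> D" for x y
  proof -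
    obtain u v where "x = \<T> u" "y = \<T> v" using xy D by auto
    then show ?thesis using A[of "u + v"] by (simp add: A blinfun.add_right)
  qed
  have A_scaleR: "A (c *\<^sub>R x) = c *\<^sub>R A x" if x: "x \<in> D" for x c
  proof -
    obtain u where "x = \<T> u" using x D by auto
    then show ?thesis using A[of "c *\<^sub>R u"] by (simp add: A blinfun.scaleR_right)
  qed
  \<comment> \<open>Both conditions are compared for one fixed \<open>\<mu>\<close>, so the same
    \<open>\<mu> > \<omega>\<close> witnesses either side. Substituting \<open>x = \<T> v\<close>
    turns solvability into surjectivity of \<open>\<mu> *\<^sub>R \<T> - \<A>\<close>.\<close>
  have "(\<forall>f. \<exists>x\<in>D. \<mu> *\<^sub>R x - A x = f) \<longleftrightarrow>
      (\<exists>\<epsilon>>0. \<forall>v. norm (\<mu> *\<^sub>R adjoint \<T> v - adjoint \<A> v) \<ge> \<epsilon> * norm v)" for \<mu>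
  proof -
    have eq: "adjoint (\<mu> *\<^sub>R \<T> - \<A>) v = \<mu> *\<^sub>R adjoint \<T> v - adjoint \<A> v" for v
    proof (rule vector_eq_ldot[THEN iffD1], rule allI)
      fix x
      show "x \<bullet> adjoint (\<mu> *\<^sub>R \<T> - \<A>) v = x \<bullet> (\<mu> *\<^sub>R adjoint \<T> v - adjoint \<A> v)"
        by (simp add: adjoint_inner[symmetric] blinfun.bounded_linear_right inner_diff_right
            blinfun.diff_left blinfun.scaleR_left inner_diff_left)
    qed
    have "(\<forall>f. \<exists>x\<in>D. \<mu> *\<^sub>R x - A x = f) \<longleftrightarrow> surj (\<mu> *\<^sub>R \<T> - \<A>)"
      unfolding surj_def D by (auto simp: A blinfun.diff_left blinfun.scaleR_left) metis+
    then show ?thesis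
      by (simp add: surj_iff_adjoint_bounded_below blinfun.bounded_linear_right eq)
  qed
  moreover have "(\<forall>x\<in>D. x \<bullet> A x \<le> \<omega> * (x \<bullet> x)) \<longleftrightarrow> (\<forall>v. \<T> v \<bullet> \<A> v \<le> \<omega> * (\<T> v \<bullet> \<T> v))"
    by (simp add: D A)
  ultimately show ?thesis using lumer_phillips[OF assms(1) A_add A_scaleR, of \<omega>] by auto
qed

end
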